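(* Let $\eta\in H_{++}$. For $\varepsilon>0$ and $n\in\mathbb{N}$ let $k_{\varepsilon,n}\in\mathbb{N}$ and $M_{\varepsilon,n}$ be large enough to make the strategy $$c_{k_{\varepsilon,n},M_{\varepsilon,n}}(t):=\begin{cases}c^{*,n}_{k_{\varepsilon,n}}(t),& t\in[0,M_{\varepsilon,n}],\\ 0,& t>M_{\varepsilon,n},\end{cases}$$ where $c^{*,n}_k$ is the optimal feedback strategy for the problem $V_k^n(\eta)$, admissible and $\varepsilon$-optimal for the problem $V_0^n(\eta)$. Then for every $\varepsilon>0$ one can find $n_\varepsilon\in\mathbb{N}$ such that $$\lim_{\varepsilon\downarrow0}V^{n_\varepsilon}_{k_{\varepsilon,n_\varepsilon}}(\eta)=V_0^0(\eta).$$ Moreover the controls $c_{k_{\varepsilon,n_\varepsilon},M_{\varepsilon,n_\varepsilon}}(\cdot)$ are admissible and $3\varepsilon$-optimal for the problem $V_0^0(\eta)$.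
   Context: Setting. Fix $T>0$, $\rho>0$. Put $L^2_{-T}=L^2([-T,0];\mathbb{R})$, $W^{1,2}_{-T}=W^{1,2}([-T,0];\mathbb{R})$, $H_+=(0,+\infty)\times L^2_{-T}$, $H_{++}=(0,+\infty)\times\{\eta_1\in L^2_{-T}:\eta_1\ge0\text{ a.e.}\}$, with elements $\eta=(\eta_0,\eta_1(\cdot))$; $\mathbb{R}^+=[0,+\infty)$. Assumptions: $f_0:[0,\infty)\times\mathbb{R}\to\mathbb{R}$ is jointly concave, nondecreasing in the second variable, Lipschitz continuous with constant $C_{f_0}$, $f_0(0,y)>0$ for all $y>0$, and $f_0(x,0)\ge0$ for all $x\ge0$. (A linear term $rx$ in the state equation is incorporated in $f_0$.) $U_1\in C([0,\infty))\cap C^2((0,\infty))$ is bounded, $U_1'>0$, $U_1'(0^+)=+\infty$, $U_1''<0$. $(U_2^n)_{n\in\mathbb{N}}$ is a sequence of real functions on $(0,\infty)$, each continuous, increasing (not necessarily strictly), concave, bounded from above, with $\int_0^{\infty}e^{-\rho t}U_2^n(e^{-C_{f_0}t})\,dt>-\infty$, such that $U_2^n\uparrow0$ as $n\to\infty$, $U_2^n\equiv0$ on $[1/n,\infty)$, and $\lim_{x\to0^+}xU_2^n(x)=-\infty$ for every $n$. Kernels: $(a_k)_{k\in\mathbb{N}}\subset W^{1,2}_{-T}$ is a sequence with $a_k\ge0$, $a_k(-T)=0$, $\|a_k\|_{L^2_{-T}}\le1$, $\int_{-\delta}^0a_k(\xi)d\xi>0$ for all $\delta>0$, and $a_k\stackrel{*}{\rightharpoonup}\delta_{-T/2}$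 in $(C([-T,0];\mathbb{R}))^*$, where $\delta_{-T/2}$ is the Dirac measure at $-T/2$, i.e. $\int_{-T}^0a_k\varphi\,d\xi\to\varphi(-T/2)$ for all $\varphi\in C([-T,0];\mathbb{R})$. For $\eta\in H_+$ and a control $c\in L^1_{loc}([0,\infty);\mathbb{R}^+)$, $x_k(\cdot;\eta,c)$ and $y(\cdot;\eta,c)$ are the unique solutions, absolutely continuous on $[0,\infty)$, of (in integral form) $x'(t)=f_0\big(x(t),\int_{-T}^0a_k(\xi)x(t+\xi)d\xi\big)-c(t)$ and $y'(t)=f_0\big(y(t),y(t-\tfrac T2)\big)-c(t)$ respectively, with value $\eta_0$ at $0$ and equal to $\eta_1$ on $[-T,0)$. $\mathcal{C}^k_{ad}(\eta)=\{c\in L^1_{loc}([0,\infty);\mathbb{R}^+):x_k(\cdot;\eta,c)>0\}$ ($k\in\mathbb{N}$), $\mathcal{C}^0_{ad}(\eta)=\{c\in L^1_{loc}([0,\infty);\mathbb{R}^+):y(\cdot;\eta,c)>0\}$. Subscript $0$ refers to the pointwise-delay equation, superscript $0$ to no state utility: $J_k^n(\eta;c)=\int_0^\infty e^{-\rho t}[U_1(c(t))+U_2^n(x_k(t;\eta,c))]dt$ and $V_k^n(\eta)=\sup_{\mathcal{C}^k_{ad}(\eta)}J_k^n(\eta;\cdot)$; $J_0^n(\eta;c)=\int_0^\infty e^{-\rho t}[U_1(c(t))+U_2^n(y(t;\eta,c))]dt$ and $V_0^n(\eta)=\sup_{\mathcal{C}^0_{ad}(\eta)}J_0^n(\eta;\cdot)$;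 $J_0^0(\eta;c)=\int_0^\infty e^{-\rho t}U_1(c(t))dt$ and $V_0^0(\eta)=\sup_{\mathcal{C}^0_{ad}(\eta)}J_0^0(\eta;\cdot)$. A control is $\delta$-optimal for one of these problems if it is admissible for it and its objective value is greater than the value function minus $\delta$. Optimal feedback strategy for $V_k^n$: $V_k^n$ is known to be differentiable in the direction $\eta_0$ on $\{\eta\in H_+:V_k^n(\eta)>-\infty\}\supset H_{++}$ with continuous derivative $\partial_{\eta_0}V_k^n>0$; with $C_k^n(\zeta)=\mathrm{argmax}_{c\ge0}(U_1(c)-c\,\partial_{\eta_0}V_k^n(\zeta))$, one sets $c_k^{*,n}(t)=C_k^n(x^*(t),x^*(t+\xi)|_{\xi\in[-T,0]})$ where $x^*>0$ solves the state equation with kernel $a_k$, initial datum $\eta$ and $c(t)$ replaced by $C_k^n(x(t),x(t+\xi)|_{\xi\in[-T,0]})$; then $c_k^{*,n}\in\mathcal{C}^k_{ad}(\eta)$ and $J_k^n(\eta;c_k^{*,n})=V_k^n(\eta)$. For fixed $n$, the problems $V_k^n$ approximate $V_0^n$ as $k\to\infty$: $V_k^n(\eta)\to V_0^n(\eta)$, and for every $\varepsilon>0$ it is known that one can produce $k_{\varepsilon,n}$ and $M_{\varepsilon,n}$ large enough to make the strategy $c_{k_{\varepsilon,n},M_{\varepsilon,n}}$ (equal to $c^{*,n}_{k_{\varepsilon,n}}$ on $[0,M_{\varepsilon,n}]$ and to $0$ afterwards) admissible and $\varepsilon$-optimal for $V_0^n(\eta)$; these are the $k_{\varepsilon,n}$,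 $M_{\varepsilon,n}$ of the claim. *)

theory Defs
  imports "HOL-Analysis.Analysis"
begin

(* Integral over [0, \<infinity>) with values in [-\<infinity>, \<infinity>].  All integrands below
   are bounded above by an integrable function, so \<infinity> - \<infinity> never occurs. *)
definition ext_integral :: "(real \<Rightarrow> real) \<Rightarrow> ereal" where
  "ext_integral g =
     enn2ereal (\<integral>\<^sup>+ t\<in>{0..}. ennreal (g t) \<partial>lborel) -
     enn2ereal (\<integral>\<^sup>+ t\<in>{0..}. ennreal (- g t) \<partial>lborel)"

(* Elements of L^2([-T,0]) are represented by functions on the reals, of which only the
   restriction to [-T,0] matters. *)
definition L2 :: "real \<Rightarrow> (real \<Rightarrow> real) set" where
  "L2 T = {g. set_borel_measurable lborel {-T..0} g \<and>
              set_integrable lborel {-T..0} (\<lambda>\<xi>. (g \<xi>)\<^sup>2)}"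

(* W^{1,2}([-T,0]), identified as usual with the absolutely continuous functions having
   a square integrable derivative (g below). *)
definition W12 :: "real \<Rightarrow> (real \<Rightarrow> real) set" where
  "W12 T = {h. \<exists>g\<in>L2 T. \<forall>\<xi>\<in>{-T..0}. h \<xi> = h (-T) + (LBINT s:{-T..\<xi>}. g s)}"

type_synonym datum = "real \<times> (real \<Rightarrow> real)"

definition H_pp :: "real \<Rightarrow> datum set" where
  "H_pp T = {\<eta>. fst \<eta> > 0 \<and> snd \<eta> \<in> L2 T \<and>
                (AE \<xi> in lborel. \<xi> \<in> {-T..0} \<longrightarrow> snd \<eta> \<xi> \<ge> 0)}"

definition controls :: "(real \<Rightarrow> real) set" where
  "controls = {c. (\<forall>t\<ge>0. c t \<ge> 0) \<and> (\<forall>t\<ge>0. set_integrable lborel {0..t} c)}"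

definition production_function :: "(real \<Rightarrow> real \<Rightarrow> real) \<Rightarrow> real \<Rightarrow> bool" where
  "production_function f0 C \<longleftrightarrow>
     concave_on ({0..} \<times> UNIV) (\<lambda>(x, y). f0 x y) \<and>
     (\<forall>x\<ge>0. mono (f0 x)) \<and>
     C-lipschitz_on ({0..} \<times> UNIV) (\<lambda>(x, y). f0 x y) \<and>
     (\<forall>y>0. f0 0 y > 0) \<and>
     (\<forall>x\<ge>0. f0 x 0 \<ge> 0)"

definition consumption_utility :: "(real \<Rightarrow> real) \<Rightarrow> bool" where
  "consumption_utility U1 \<longleftrightarrow>
     continuous_on {0..} U1 \<and>
     bounded (U1 ` {0..}) \<and>
     (\<forall>x>0. U1 differentiable (at x)) \<and>
     (\<forall>x>0. deriv U1 differentiable (at x)) \<and>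
     continuous_on {0<..} (deriv (deriv U1)) \<and>
     (\<forall>x>0. deriv U1 x > 0) \<and>
     filterlim (deriv U1) at_top (at_right 0) \<and>
     (\<forall>x>0. deriv (deriv U1) x < 0)"

(* Here and below the sequences are indexed by n = 1, 2, ...; the entry 0 is ignored. *)
definition state_utilities :: "real \<Rightarrow> real \<Rightarrow> (nat \<Rightarrow> real \<Rightarrow> real) \<Rightarrow> bool" where
  "state_utilities \<rho> C U2 \<longleftrightarrow>
     (\<forall>n\<ge>1. continuous_on {0<..} (U2 n) \<and>
            mono_on {0<..} (U2 n) \<and>
            concave_on {0<..} (U2 n) \<and>
            bdd_above (U2 n ` {0<..}) \<and>
            ext_integral (\<lambda>t. exp (- \<rho> * t) * U2 n (exp (- C * t))) > - \<infinity> \<and>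
            (\<forall>x \<ge> 1 / real n. U2 n x = 0) \<and>
            filterlim (\<lambda>x. x * U2 n x) at_bot (at_right 0)) \<and>
     (\<forall>x>0. (\<forall>n\<ge>1. U2 n x \<le> U2 (Suc n) x) \<and> (\<lambda>n. U2 n x) \<longlonglongrightarrow> 0)"

(* No bound on the L^2 norms of the kernels is imposed.  A bound such as 1 would contradict
   the last condition: it would give |\<phi>(-T/2)| \<le> ||\<phi>|| (L^2 norm) for every continuous \<phi>.
   A uniform bound on the L^1 norms follows from nonnegativity and \<phi> = 1. *)
definition kernels :: "real \<Rightarrow> (nat \<Rightarrow> real \<Rightarrow> real) \<Rightarrow> bool" where
  "kernels T a \<longleftrightarrow>
     (\<forall>k\<ge>1. a k \<in> W12 T \<and>
            (\<forall>\<xi>\<in>{-T..0}. a k \<xi> \<ge> 0) \<and>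
            a k (-T) = 0 \<and>
            (\<forall>\<delta>\<in>{0<..T}. (LBINT \<xi>:{-\<delta>..0}. a k \<xi>) > 0)) \<and>
     (\<forall>\<phi>. continuous_on {-T..0} \<phi> \<longrightarrow>
            (\<lambda>k. LBINT \<xi>:{-T..0}. a k \<xi> * \<phi> \<xi>) \<longlonglongrightarrow> \<phi> (- T / 2))"

(* The two memory terms: the state equation is x' = f0(x, D x) - c with a memory operator D. *)
definition distributed_delay :: "real \<Rightarrow> (real \<Rightarrow> real) \<Rightarrow> (real \<Rightarrow> real) \<Rightarrow> real \<Rightarrow> real" where
  "distributed_delay T a x t = (LBINT \<xi>:{-T..0}. a \<xi> * x (t + \<xi>))"

definition pointwise_delay :: "real \<Rightarrow> (real \<Rightarrow> real) \<Rightarrow> real \<Rightarrow> real" where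
  "pointwise_delay T x t = x (t - T / 2)"

(* f0 is only given on [0, \<infinity>) \<times> R; for x < 0 it is extended by f0(x, y) = f0(0, y), so that
   the equation makes sense for every control.  Admissible trajectories are positive and do
   not see the extension.  The value 0 before -T is a convention making the solution unique as
   a function on the reals. *)
definition is_trajectory ::
  "(real \<Rightarrow> real \<Rightarrow> real) \<Rightarrow> real \<Rightarrow> ((real \<Rightarrow> real) \<Rightarrow> real \<Rightarrow> real) \<Rightarrow> datum \<Rightarrow>
   (real \<Rightarrow> real) \<Rightarrow> (real \<Rightarrow> real) \<Rightarrow> bool" where
  "is_trajectory f0 T D \<eta> c x \<longleftrightarrow>
     (\<forall>t. t < - T \<longrightarrow> x t = 0) \<and>
     (\<forall>t\<in>{-T..<0}. x t = snd \<eta> t) \<and>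
     (\<forall>t\<ge>0. set_integrable lborel {0..t} (\<lambda>s. f0 (max 0 (x s)) (D x s) - c s) \<and>
            x t = fst \<eta> + (LBINT s:{0..t}. f0 (max 0 (x s)) (D x s) - c s))"

definition trajectory ::
  "(real \<Rightarrow> real \<Rightarrow> real) \<Rightarrow> real \<Rightarrow> ((real \<Rightarrow> real) \<Rightarrow> real \<Rightarrow> real) \<Rightarrow> datum \<Rightarrow>
   (real \<Rightarrow> real) \<Rightarrow> real \<Rightarrow> real" where
  "trajectory f0 T D \<eta> c = (THE x. is_trajectory f0 T D \<eta> c x)"

definition admissible ::
  "(real \<Rightarrow> real \<Rightarrow> real) \<Rightarrow> real \<Rightarrow> ((real \<Rightarrow> real) \<Rightarrow> real \<Rightarrow> real) \<Rightarrow> datum \<Rightarrow>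
   (real \<Rightarrow> real) set" where
  "admissible f0 T D \<eta> = {c \<in> controls. \<forall>t\<ge>0. trajectory f0 T D \<eta> c t > 0}"

definition objective ::
  "(real \<Rightarrow> real \<Rightarrow> real) \<Rightarrow> real \<Rightarrow> ((real \<Rightarrow> real) \<Rightarrow> real \<Rightarrow> real) \<Rightarrow>
   real \<Rightarrow> (real \<Rightarrow> real) \<Rightarrow> (real \<Rightarrow> real) \<Rightarrow> datum \<Rightarrow> (real \<Rightarrow> real) \<Rightarrow> ereal" where
  "objective f0 T D \<rho> U1 U \<eta> c =
     ext_integral (\<lambda>t. exp (- \<rho> * t) * (U1 (c t) + U (trajectory f0 T D \<eta> c t)))"

definition value_fn ::
  "(real \<Rightarrow> real \<Rightarrow> real) \<Rightarrow> real \<Rightarrow> ((real \<Rightarrow> real) \<Rightarrow> real \<Rightarrow> real) \<Rightarrow>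
   real \<Rightarrow> (real \<Rightarrow> real) \<Rightarrow> (real \<Rightarrow> real) \<Rightarrow> datum \<Rightarrow> ereal" where
  "value_fn f0 T D \<rho> U1 U \<eta> =
     (SUP c \<in> admissible f0 T D \<eta>. objective f0 T D \<rho> U1 U \<eta> c)"

definition delta_optimal ::
  "(real \<Rightarrow> real \<Rightarrow> real) \<Rightarrow> real \<Rightarrow> ((real \<Rightarrow> real) \<Rightarrow> real \<Rightarrow> real) \<Rightarrow>
   real \<Rightarrow> (real \<Rightarrow> real) \<Rightarrow> (real \<Rightarrow> real) \<Rightarrow> datum \<Rightarrow> real \<Rightarrow> (real \<Rightarrow> real) \<Rightarrow> bool" where
  "delta_optimal f0 T D \<rho> U1 U \<eta> \<delta> c \<longleftrightarrow>
     c \<in> admissible f0 T D \<eta> \<and>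
     objective f0 T D \<rho> U1 U \<eta> c > value_fn f0 T D \<rho> U1 U \<eta> - ereal \<delta>"

definition partial_eta0 :: "(datum \<Rightarrow> ereal) \<Rightarrow> datum \<Rightarrow> real" where
  "partial_eta0 V \<zeta> = deriv (\<lambda>z. real_of_ereal (V (z, snd \<zeta>))) (fst \<zeta>)"

definition feedback_map :: "(real \<Rightarrow> real) \<Rightarrow> (datum \<Rightarrow> ereal) \<Rightarrow> datum \<Rightarrow> real" where
  "feedback_map U1 V \<zeta> = arg_max (\<lambda>c. U1 c - c * partial_eta0 V \<zeta>) (\<lambda>c. c \<ge> 0)"

definition feedback_strategy ::
  "(real \<Rightarrow> real \<Rightarrow> real) \<Rightarrow> real \<Rightarrow> ((real \<Rightarrow> real) \<Rightarrow> real \<Rightarrow> real) \<Rightarrow>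
   real \<Rightarrow> (real \<Rightarrow> real) \<Rightarrow> (real \<Rightarrow> real) \<Rightarrow> datum \<Rightarrow> (real \<Rightarrow> real) \<Rightarrow> bool" where
  "feedback_strategy f0 T D \<rho> U1 U \<eta> c \<longleftrightarrow>
     (\<exists>x. is_trajectory f0 T D \<eta>
            (\<lambda>t. feedback_map U1 (value_fn f0 T D \<rho> U1 U) (x t, \<lambda>\<xi>. x (t + \<xi>))) x \<and>
          (\<forall>t\<ge>0. x t > 0) \<and>
          (\<forall>t\<ge>0. c t = feedback_map U1 (value_fn f0 T D \<rho> U1 U) (x t, \<lambda>\<xi>. x (t + \<xi>))))"

definition optimal_feedback_strategy ::
  "(real \<Rightarrow> real \<Rightarrow> real) \<Rightarrow> real \<Rightarrow> ((real \<Rightarrow> real) \<Rightarrow> real \<Rightarrow> real) \<Rightarrow>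
   real \<Rightarrow> (real \<Rightarrow> real) \<Rightarrow> (real \<Rightarrow> real) \<Rightarrow> datum \<Rightarrow> (real \<Rightarrow> real) \<Rightarrow> bool" where
  "optimal_feedback_strategy f0 T D \<rho> U1 U \<eta> c \<longleftrightarrow>
     feedback_strategy f0 T D \<rho> U1 U \<eta> c \<and>
     c \<in> admissible f0 T D \<eta> \<and>
     objective f0 T D \<rho> U1 U \<eta> c = value_fn f0 T D \<rho> U1 U \<eta>"

definition stop_after :: "real \<Rightarrow> (real \<Rightarrow> real) \<Rightarrow> real \<Rightarrow> real" where
  "stop_after M c t = (if t \<le> M then c t else 0)"

end

theory Submission
  imports Defs
begin

text \<open>The Picard operator of the state equation is order preserving on nonnegative paths, because a
concave production function that is bounded below is nondecreasing. Hence every nonnegative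
subsolution lies below the trajectory. In particular the trajectory is a concave function of the
control, and it stays above \<open>\<eta>\<^sub>0\<close> for the zero control. So replacing an admissible control \<open>c\<close> by
\<open>(1 - l) c\<close> keeps the capital above \<open>l \<eta>\<^sub>0\<close>, where the state utility vanishes once \<open>1 / n \<le> l \<eta>\<^sub>0\<close>, at
a cost of order \<open>l\<close> that depends neither on the kernel nor on \<open>n\<close>. This gives \<open>3\<epsilon>\<close>-optimality and the
lower bound for the values, with \<open>n\<^sub>\<epsilon>\<close> chosen uniformly in the kernels.

For the upper bound, \<open>V\<close> for the kernel problem exceeds the pure consumption utility of the stopped
strategy by at most a multiple of \<open>exp (-\<rho> M)\<close>. The stopping times tend to infinity: since
\<open>U\<^sub>1'(0+) = \<infinity>\<close>, a control that stops by a fixed time is beaten by a fixed margin, by mixing in a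
small consumption afterwards.\<close>

section \<open>Integrals, kernels and production functions\<close>

text \<open>Positive and negative parts are compared separately, so integrals equal to -\<infinity>
  are covered as well. This is what later allows a nonpositive state utility to be
  discarded.\<close>

lemma ext_integral_mono:
  assumes "\<And>t. t \<ge> 0 \<Longrightarrow> g t \<le> h t"
  shows "ext_integral g \<le> ext_integral h"
proof -
  have "(\<integral>\<^sup>+ t\<in>{0..}. ennreal (g t) \<partial>lborel) \<le> (\<integral>\<^sup>+ t\<in>{0..}. ennreal (h t) \<partial>lborel)"
    by (intro nn_integral_mono) (auto simp: indicator_def intro: ennreal_leI assms)
  moreover have "(\<integral>\<^sup>+ t\<in>{0..}. ennreal (- h t) \<partial>lborel) \<le> (\<integral>\<^sup>+ t\<in>{0..}. ennreal (- g t) \<partial>lborel)"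
    by (intro nn_integral_mono) (auto simp: indicator_def intro!: ennreal_leI assms)
  ultimately show ?thesis
    unfolding ext_integral_def by (intro ereal_minus_mono) (simp_all add: less_eq_ennreal.rep_eq)
qed

lemma ext_integral_eq_set_integral:
  assumes "set_integrable lborel {0..} g"
  shows "ext_integral g = ereal (LBINT t:{0..}. g t)"
proof -
  define G where "G t = indicator {0..} t * g t" for t :: real
  have G: "integrable lborel G"
    using assms unfolding set_integrable_def G_def by simp
  have pos: "(\<integral>\<^sup>+ t\<in>{0..}. ennreal (g t) \<partial>lborel) = (\<integral>\<^sup>+ t. ennreal (G t) \<partial>lborel)"
    by (intro nn_integral_cong) (auto simp: G_def indicator_def)
  have neg: "(\<integral>\<^sup>+ t\<in>{0..}. ennreal (- g t) \<partial>lborel) = (\<integral>\<^sup>+ t. ennreal (- G t) \<partial>lborel)"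
    by (intro nn_integral_cong) (auto simp: G_def indicator_def)
  have real: "enn2ereal x = ereal (enn2real x)" if "x \<noteq> \<infinity>" for x
    using that by (cases x) auto
  show ?thesis
    using G real_lebesgue_integral_def[OF G]
    by (simp add: ext_integral_def pos neg real real_integrable_def set_lebesgue_integral_def G_def[symmetric])
qed

lemma continuous_on_atLeast_real:
  fixes f :: "real \<Rightarrow> 'a::topological_space"
  assumes "\<And>b. b \<ge> a \<Longrightarrow> continuous_on {a..b} f"
  shows "continuous_on {a..} f"
  unfolding continuous_on_eq_continuous_within
proof
  fix x assume x: "x \<in> {a..}"
  \<comment> \<open>Continuity is local: near \<open>x\<close> the half-line coincides with the
    interval \<open>{a..x + 1}\<close>.\<close>
  have "at x within {a..} = at x within {a..x + 1}"
    by (rule at_within_nhd[of x "{x - 1<..<x + 1}"]) auto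
  then show "continuous (at x within {a..}) f"
    using assms[of "x + 1"] x by (auto simp: continuous_on_eq_continuous_within)
qed

lemma continuous_on_indefinite_set_integral:
  fixes g :: "real \<Rightarrow> real"
  assumes "\<And>t. t \<ge> 0 \<Longrightarrow> set_integrable lborel {0..t} g"
  shows "continuous_on {0..} (\<lambda>t. LBINT s:{0..t}. g s)"
proof (rule continuous_on_atLeast_real)
  fix b :: real assume b: "b \<ge> 0"
  have "continuous_on {0..b} (\<lambda>t. integral {0..t} g)"
    by (intro indefinite_integral_continuous_1 set_borel_integral_eq_integral assms b)
  then show "continuous_on {0..b} (\<lambda>t. LBINT s:{0..t}. g s)"
    by (rule continuous_on_eq) (auto simp: set_borel_integral_eq_integral(2) assms)
qed

lemma set_integrable_continuous_compact:
  fixes f :: "real \<Rightarrow> real"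
  shows "compact S \<Longrightarrow> continuous_on S f \<Longrightarrow> set_integrable lborel S f"
  unfolding set_integrable_def by (rule borel_integrable_compact)

lemma set_integral_exp:
  fixes b :: real
  assumes "b \<noteq> 0" "0 \<le> t"
  shows "(LBINT s:{0..t}. exp (b * s)) = (exp (b * t) - 1) / b"
proof -
  have "(\<integral>x. exp (b * x) * indicator {0..t} x \<partial>lborel) = exp (b * t) / b - exp (b * 0) / b"
    by (rule integral_FTC_Icc_real)
      (use assms in \<open>auto intro!: derivative_eq_intros continuous_intros\<close>)
  then show ?thesis
    by (simp add: set_lebesgue_integral_def mult.commute diff_divide_distrib)
qed

lemma L2_set_integrable:
  assumes "g \<in> L2 T"
  shows "set_integrable lborel {-T..0} g"
proof (rule set_integrable_bound)
  show "set_integrable lborel {-T..0} (\<lambda>\<xi>. 1 + (g \<xi>)\<^sup>2)"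
    using assms by (intro set_integral_add(1) set_integrable_continuous_compact[of _ "\<lambda>_. 1"]) (auto simp: L2_def)
  show "set_borel_measurable lborel {-T..0} g"
    using assms by (simp add: L2_def)
  \<comment> \<open>Expanding the square of \<open>\<bar>x\<bar> - 1\<close>; on a bounded interval
    the bound is integrable.\<close>
  have "\<bar>x\<bar> \<le> 1 + x\<^sup>2" for x :: real
    using zero_le_power2[of "\<bar>x\<bar> - 1"] abs_ge_zero[of x] by (simp add: power2_diff)
  then show "AE x in lborel. x \<in> {-T..0} \<longrightarrow> norm (g x) \<le> norm (1 + (g x)\<^sup>2)"
    by simp
qed

text \<open>The variation is controlled by the L^1 norm of the derivative. A bounded kernel can be
  multiplied with a merely integrable path without losing integrability.\<close>

lemma W12_bounded:
  assumes "h \<in> W12 T"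
  obtains K where "K \<ge> 0" "\<And>\<xi>. \<xi> \<in> {-T..0} \<Longrightarrow> \<bar>h \<xi>\<bar> \<le> K"
proof -
  obtain g where g: "g \<in> L2 T" and h: "\<And>\<xi>. \<xi> \<in> {-T..0} \<Longrightarrow> h \<xi> = h (-T) + (LBINT s:{-T..\<xi>}. g s)"
    using assms unfolding W12_def by blast
  define K where "K = \<bar>h (-T)\<bar> + (LBINT s:{-T..0}. \<bar>g s\<bar>)"
  have g1: "set_integrable lborel {-T..0} g"
    by (rule L2_set_integrable[OF g])
  have bound: "\<bar>h \<xi>\<bar> \<le> K" if \<xi>: "\<xi> \<in> {-T..0}" for \<xi>
  proof -
    have sub: "set_integrable lborel {-T..\<xi>} g"
      by (rule set_integrable_subset[OF g1]) (use \<xi> in auto)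
    have "\<bar>LBINT s:{-T..\<xi>}. g s\<bar> \<le> (LBINT s:{-T..\<xi>}. \<bar>g s\<bar>)"
      using set_integral_norm_bound[OF sub] by simp
    also have "\<dots> \<le> (LBINT s:{-T..0}. \<bar>g s\<bar>)"
      unfolding set_lebesgue_integral_def
    proof (rule integral_mono)
      show "integrable lborel (\<lambda>s. indicator {-T..\<xi>} s *\<^sub>R \<bar>g s\<bar>)"
        using set_integrable_abs[OF sub] unfolding set_integrable_def .
      show "integrable lborel (\<lambda>s. indicator {-T..0} s *\<^sub>R \<bar>g s\<bar>)"
        using set_integrable_abs[OF g1] unfolding set_integrable_def .
    qed (use \<xi> in \<open>auto simp: indicator_def\<close>)
    finally show ?thesis using h[OF \<xi>] unfolding K_def by linarith
  qed
  have "K \<ge> 0"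
    unfolding K_def set_lebesgue_integral_def
    by (intro add_nonneg_nonneg Bochner_Integration.integral_nonneg) auto
  then show ?thesis using bound by (rule that)
qed

section \<open>Production functions: Lipschitz bound, concavity and monotonicity\<close>

context
  fixes f0 C
  assumes pf: "production_function f0 C"
begin

lemma production_lipschitz_const_nonneg: "C \<ge> 0"
  using pf by (auto simp: production_function_def dest: lipschitz_on_nonneg)

text \<open>Truncation at 0 is 1-Lipschitz and the Euclidean norm is at most the sum norm. The
  estimate thus fits the extension of \<open>f0\<close> to negative capital and separates the state
  from the memory term.\<close>

lemma production_lipschitz:
  "\<bar>f0 (max 0 x) y - f0 (max 0 x') y'\<bar> \<le> C * (\<bar>x - x'\<bar> + \<bar>y - y'\<bar>)"
proof -
  have "C-lipschitz_on ({0..} \<times> UNIV) (\<lambda>(x, y). f0 x y)"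
    using pf by (simp add: production_function_def)
  from lipschitz_onD[OF this, of "(max 0 x, y)" "(max 0 x', y')"]
  have "\<bar>f0 (max 0 x) y - f0 (max 0 x') y'\<bar> \<le> C * dist (max 0 x, y) (max 0 x', y')"
    by (simp add: dist_real_def)
  also have "dist (max 0 x, y) (max 0 x', y') \<le> \<bar>max 0 x - max 0 x'\<bar> + \<bar>y - y'\<bar>"
    by (simp add: dist_prod_def dist_real_def sqrt_sum_squares_le_sum_abs)
  also have "\<bar>max 0 x - max 0 x'\<bar> \<le> \<bar>x - x'\<bar>"
    by (simp add: max_def)
  finally show ?thesis
    using production_lipschitz_const_nonneg by (simp add: mult_left_mono)
qed

lemma production_concave:
  assumes "x \<ge> 0" "x' \<ge> 0" "u \<ge> 0" "v \<ge> 0" "u + v = 1"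
  shows "u * f0 x y + v * f0 x' y' \<le> f0 (u * x + v * x') (u * y + v * y')"
proof -
  have "concave_on ({0..} \<times> UNIV) (\<lambda>(x, y). f0 x y)"
    using pf by (simp add: production_function_def)
  then have *: "\<And>p q. p \<in> {0..} \<times> UNIV \<Longrightarrow> q \<in> {0..} \<times> UNIV \<Longrightarrow>
      (case u *\<^sub>R p + v *\<^sub>R q of (x, y) \<Rightarrow> f0 x y) \<ge>
      u * (case p of (x, y) \<Rightarrow> f0 x y) + v * (case q of (x, y) \<Rightarrow> f0 x y)"
    using assms unfolding concave_on_iff by blast
  show ?thesis using *[of "(x, y)" "(x', y')"] assms by simp
qed

lemma production_nonneg:
  assumes "x \<ge> 0" "y \<ge> 0"
  shows "f0 x y \<ge> 0"
proof -
  have "f0 x 0 \<ge> 0" "mono (f0 x)"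
    using pf assms by (auto simp: production_function_def)
  then show ?thesis using monoD[of "f0 x" 0 y] assms by linarith
qed

text \<open>A concave function that is bounded below on a half-line is nondecreasing.\<close>
lemma production_mono:
  assumes "0 \<le> x" "x \<le> x'" "0 \<le> y" "y \<le> y'"
  shows "f0 x y \<le> f0 x' y'"
proof -
  have "f0 x y \<le> f0 x' y"
  proof (rule field_le_mult_one_interval)
    fix z :: real assume z: "0 < z" "z < 1"
    define X where "X = x + (x' - x) / (1 - z)"
    have X: "X \<ge> 0" "z * x + (1 - z) * X = x'"
      using z assms by (simp_all add: X_def) (simp add: field_simps)
    have "z * f0 x y \<le> z * f0 x y + (1 - z) * f0 X y"
      using z production_nonneg[of X y] X assms by simp
    also have "\<dots> \<le> f0 (z * x + (1 - z) * X) (z * y + (1 - z) * y)"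
      using z X assms by (intro production_concave) auto
    finally show "z * f0 x y \<le> f0 x' y" 
      using X by (simp add: algebra_simps)
  qed
  moreover have "mono (f0 x')"
    using pf assms by (auto simp: production_function_def)
  ultimately show ?thesis using monoD[of "f0 x'" y y'] assms by linarith
qed

lemma production_measurable:
  "(\<lambda>p. f0 (max 0 (fst p)) (snd p)) \<in> borel_measurable borel"
proof (intro borel_measurable_continuous_onI)
  have "continuous_on ({0..} \<times> UNIV) (\<lambda>(x, y). f0 x y)"
    using pf by (auto simp: production_function_def intro: lipschitz_on_continuous_on)
  moreover have "continuous_on UNIV (\<lambda>p::real \<times> real. (max 0 (fst p), snd p))"
    by (intro continuous_intros)
  ultimately show "continuous_on UNIV (\<lambda>p. f0 (max 0 (fst p)) (snd p))"
    using continuous_on_compose2[of "{0..} \<times> UNIV" "\<lambda>(x, y). f0 x y" UNIV "\<lambda>p. (max 0 (fst p), snd p)"]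
    by (simp add: image_subset_iff)
qed

end

text \<open>The space on which the Picard operator acts. The value at 0 is left free: the iteration
  starts from a path that is 0 on [0, \<infinity>), and comparison paths may start below
  \<open>fst \<eta>\<close>.\<close>

definition paths :: "real \<Rightarrow> datum \<Rightarrow> (real \<Rightarrow> real) set" where
  "paths T \<eta> = {x. (\<forall>t. t < - T \<longrightarrow> x t = 0) \<and> (\<forall>t\<in>{-T..<0}. x t = snd \<eta> t) \<and> continuous_on {0..} x}"

lemma paths_cont: "x \<in> paths T \<eta> \<Longrightarrow> continuous_on {0..} x"
  by (simp add: paths_def)

lemma paths_agree: "x \<in> paths T \<eta> \<Longrightarrow> y \<in> paths T \<eta> \<Longrightarrow> t < 0 \<Longrightarrow> x t = y t"
  unfolding paths_def by (cases "t < -T") auto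

lemma paths_convex:
  assumes "x \<in> paths T \<eta>" "y \<in> paths T \<eta>" "u + v = (1::real)"
  shows "(\<lambda>t. u * x t + v * y t) \<in> paths T \<eta>"
  using assms unfolding paths_def
  by (simp add: distrib_right[symmetric] continuous_on_add continuous_on_mult_left)

lemma paths_set_integrable:
  "x \<in> paths T \<eta> \<Longrightarrow> set_integrable lborel {0..t} x"
  by (rule set_integrable_continuous_compact) (auto intro: continuous_on_subset dest: paths_cont)

lemma controls_nonneg: "c \<in> controls \<Longrightarrow> t \<ge> 0 \<Longrightarrow> c t \<ge> 0"
  by (simp add: controls_def)

lemma controls_integrable: "c \<in> controls \<Longrightarrow> t \<ge> 0 \<Longrightarrow> set_integrable lborel {0..t} c"
  by (simp add: controls_def)

lemma controls_convex:
  assumes "b \<in> controls" "c \<in> controls" "u \<ge> 0" "v \<ge> 0"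
  shows "(\<lambda>t. u * b t + v * c t) \<in> controls"
  using assms by (auto simp: controls_def)

section \<open>The controlled delay equation\<close>

text \<open>Both delays satisfy these axioms, so trajectories are studied once.
  \<open>D_lipschitz\<close> includes causality: the memory at time \<open>t\<close> sees the common
  history and the path on [0, t] only. \<open>D_nonneg\<close> is an almost everywhere statement
  because the initial history is nonnegative only almost everywhere.\<close>

locale delayed_equation =
  fixes f0 :: "real \<Rightarrow> real \<Rightarrow> real" and C T :: real and \<eta> :: datum
    and D :: "(real \<Rightarrow> real) \<Rightarrow> real \<Rightarrow> real" and A :: real
  assumes production: "production_function f0 C"
    and T_pos: "T > 0"
    and eta0_pos: "fst \<eta> > 0"
    and A_nonneg: "A \<ge> 0"
    and D_integrable: "\<And>x t. x \<in> paths T \<eta> \<Longrightarrow> t \<ge> 0 \<Longrightarrow> set_integrable lborel {0..t} (D x)"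
    and D_lipschitz: "\<And>x y t b. x \<in> paths T \<eta> \<Longrightarrow> y \<in> paths T \<eta> \<Longrightarrow> t \<ge> 0 \<Longrightarrow>
          (\<And>s. s \<in> {0..t} \<Longrightarrow> \<bar>x s - y s\<bar> \<le> b) \<Longrightarrow> \<bar>D x t - D y t\<bar> \<le> A * b"
    and D_mono: "\<And>x y t. x \<in> paths T \<eta> \<Longrightarrow> y \<in> paths T \<eta> \<Longrightarrow> t \<ge> 0 \<Longrightarrow>
          (\<And>s. s \<in> {0..t} \<Longrightarrow> x s \<le> y s) \<Longrightarrow> D x t \<le> D y t"
    and D_convex: "\<And>x y u v t. x \<in> paths T \<eta> \<Longrightarrow> y \<in> paths T \<eta> \<Longrightarrow> u + v = 1 \<Longrightarrow> t \<ge> 0 \<Longrightarrow>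
          D (\<lambda>s. u * x s + v * y s) t = u * D x t + v * D y t"
    and D_nonneg: "\<And>x. x \<in> paths T \<eta> \<Longrightarrow> (\<And>s. s \<ge> 0 \<Longrightarrow> x s \<ge> 0) \<Longrightarrow>
          AE s in lborel. s \<ge> 0 \<longrightarrow> D x s \<ge> 0"
begin

section \<open>The Picard operator, its contraction property and its fixed points\<close>

definition rhs :: "(real \<Rightarrow> real) \<Rightarrow> real \<Rightarrow> real" where
  "rhs x s = f0 (max 0 (x s)) (D x s)"

definition picard :: "(real \<Rightarrow> real) \<Rightarrow> (real \<Rightarrow> real) \<Rightarrow> real \<Rightarrow> real" where
  "picard c x t = (if t < - T then 0 else if t < 0 then snd \<eta> t
                   else fst \<eta> + (LBINT s:{0..t}. rhs x s - c s))"

text \<open>\<open>C * (1 + A)\<close> is a Lipschitz constant of \<open>rhs\<close> for the uniform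
  distance; the factor 2 yields contraction by 1/2, and the summand 1 keeps the exponent
  positive.\<close>

definition rate :: real where
  "rate = 2 * (C * (1 + A)) + 1"

lemma C_nonneg: "C \<ge> 0"
  using production by (rule production_lipschitz_const_nonneg)

lemma rate_pos: "rate > 0"
  using C_nonneg A_nonneg by (simp add: rate_def add_nonneg_pos)

text \<open>Lipschitz continuity implies linear growth, so integrability of the path and of its
  memory term passes to the right-hand side.\<close>

lemma rhs_integrable:
  assumes x: "x \<in> paths T \<eta>" and t: "t \<ge> 0"
  shows "set_integrable lborel {0..t} (rhs x)"
proof (rule set_integrable_bound)
  let ?b = "\<lambda>s. \<bar>f0 0 0\<bar> + C * (\<bar>x s\<bar> + \<bar>D x s\<bar>)"
  have ix: "set_integrable lborel {0..t} x" and iD: "set_integrable lborel {0..t} (D x)"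
    using paths_set_integrable[OF x] D_integrable[OF x t] by auto
  show "set_integrable lborel {0..t} ?b"
    by (intro set_integral_add(1) set_integrable_continuous_compact[of _ "\<lambda>_. \<bar>f0 0 0\<bar>"]
        set_integrable_mult_right set_integrable_abs ix iD) auto
  have [measurable]: "(\<lambda>s. indicator {0..t} s * x s) \<in> borel_measurable lborel"
      "(\<lambda>s. indicator {0..t} s * D x s) \<in> borel_measurable lborel"
    using ix iD by (auto simp: set_integrable_def)
  \<comment> \<open>Measurability of state and memory is at hand only on \<open>{0..t}\<close>, so
    both arguments are cut off; the outer indicator added next makes the change invisible.\<close>
  have "(\<lambda>s. f0 (max 0 (fst (indicator {0..t} s * x s, indicator {0..t} s * D x s)))
      (snd (indicator {0..t} s * x s, indicator {0..t} s * D x s))) \<in> borel_measurable lborel"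
    by (rule measurable_compose[OF _ production_measurable[OF production]]) measurable
  then have "(\<lambda>s. indicator {0..t} s * f0 (max 0 (indicator {0..t} s * x s)) (indicator {0..t} s * D x s))
      \<in> borel_measurable lborel"
    by simp
  also have "(\<lambda>s. indicator {0..t} s * f0 (max 0 (indicator {0..t} s * x s)) (indicator {0..t} s * D x s))
      = (\<lambda>s. indicator {0..t} s *\<^sub>R rhs x s)"
    by (auto simp: rhs_def indicator_def)
  finally show "set_borel_measurable lborel {0..t} (rhs x)"
    by (simp add: set_borel_measurable_def)
  have "\<bar>rhs x s\<bar> \<le> ?b s" for s
    using production_lipschitz[OF production, of "x s" "D x s" 0 0] by (simp add: rhs_def)
  moreover have "?b s \<ge> 0" for s
    using C_nonneg by simp
  ultimately show "AE s in lborel. s \<in> {0..t} \<longrightarrow> norm (rhs x s) \<le> norm (?b s)"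
    by (simp add: C_nonneg)
qed

lemma drift_integrable:
  assumes "c \<in> controls" "x \<in> paths T \<eta>" "t \<ge> 0"
  shows "set_integrable lborel {0..t} (\<lambda>s. rhs x s - c s)"
  using assms by (intro set_integral_diff(1) rhs_integrable controls_integrable)

lemma picard_in_paths:
  assumes c: "c \<in> controls" and x: "x \<in> paths T \<eta>"
  shows "picard c x \<in> paths T \<eta>"
proof -
  have "continuous_on {0..} (\<lambda>t. fst \<eta> + (LBINT s:{0..t}. rhs x s - c s))"
    by (intro continuous_on_add continuous_on_const continuous_on_indefinite_set_integral
        drift_integrable c x)
  then have "continuous_on {0..} (picard c x)"
    by (rule continuous_on_eq) (use T_pos in \<open>auto simp: picard_def\<close>)
  then show ?thesis by (auto simp: paths_def picard_def)
qed

text \<open>An indefinite integral is continuous, so every solution lies in \<open>paths\<close> and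
  the state equation becomes a fixed point problem there.\<close>

lemma is_trajectory_iff_fixed_point:
  assumes c: "c \<in> controls"
  shows "is_trajectory f0 T D \<eta> c x \<longleftrightarrow> x \<in> paths T \<eta> \<and> picard c x = x"
proof
  assume x: "is_trajectory f0 T D \<eta> c x"
  have int: "set_integrable lborel {0..t} (\<lambda>s. rhs x s - c s)"
    and eq: "x t = fst \<eta> + (LBINT s:{0..t}. rhs x s - c s)" if "t \<ge> 0" for t
    using x that unfolding is_trajectory_def rhs_def by blast+
  have "continuous_on {0..} (\<lambda>t. fst \<eta> + (LBINT s:{0..t}. rhs x s - c s))"
    by (intro continuous_on_add continuous_on_const continuous_on_indefinite_set_integral int)
  then have "continuous_on {0..} x"
    by (rule continuous_on_eq) (simp add: eq)
  then have "x \<in> paths T \<eta>"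
    using x by (simp add: paths_def is_trajectory_def)
  moreover have "picard c x = x"
  proof
    fix t show "picard c x t = x t"
      using x eq[of t] by (simp add: picard_def is_trajectory_def)
  qed
  ultimately show "x \<in> paths T \<eta> \<and> picard c x = x" by simp
next
  assume x: "x \<in> paths T \<eta> \<and> picard c x = x"
  have "x t = fst \<eta> + (LBINT s:{0..t}. rhs x s - c s)" if "t \<ge> 0" for t
    using T_pos that fun_cong[OF conjunct2[OF x], of t] by (simp add: picard_def)
  then show "is_trajectory f0 T D \<eta> c x"
    using x drift_integrable[OF c, of x] by (simp add: is_trajectory_def paths_def rhs_def)
qed

text \<open>Bielecki's weight makes the Picard operator a contraction on every bounded interval at once.\<close>
lemma picard_contraction:
  assumes c: "c \<in> controls" and x: "x \<in> paths T \<eta>" and y: "y \<in> paths T \<eta>"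
    and b: "b \<ge> 0" and close: "\<And>s. s \<in> {0..R} \<Longrightarrow> \<bar>x s - y s\<bar> \<le> b * exp (rate * s)"
    and t: "t \<in> {0..R}"
  shows "\<bar>picard c x t - picard c y t\<bar> \<le> b / 2 * exp (rate * t)"
proof -
  have t0: "t \<ge> 0" using t by simp
  define L where "L = C * (1 + A)"
  have L: "L \<ge> 0" using C_nonneg A_nonneg by (simp add: L_def)
  have diff: "\<bar>rhs x s - rhs y s\<bar> \<le> L * b * exp (rate * s)" if s: "s \<in> {0..t}" for s
  proof -
    \<comment> \<open>The weight is increasing, so its value at \<open>s\<close> dominates the
      distance of the paths on all of [0, s], which is what the memory term sees.\<close>
    have "\<bar>D x s - D y s\<bar> \<le> A * (b * exp (rate * s))"
    proof (rule D_lipschitz[OF x y])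
      fix r assume r: "r \<in> {0..s}"
      then have "\<bar>x r - y r\<bar> \<le> b * exp (rate * r)"
        using s t by (intro close) auto
      also have "\<dots> \<le> b * exp (rate * s)"
        using r b rate_pos by (intro mult_left_mono) auto
      finally show "\<bar>x r - y r\<bar> \<le> b * exp (rate * s)" .
    qed (use s in simp)
    moreover have "\<bar>x s - y s\<bar> \<le> b * exp (rate * s)"
      using s t by (intro close) auto
    ultimately have "\<bar>x s - y s\<bar> + \<bar>D x s - D y s\<bar> \<le> (1 + A) * (b * exp (rate * s))"
      by (simp add: distrib_right)
    from mult_left_mono[OF this C_nonneg] show ?thesis
      using production_lipschitz[OF production, of "x s" "D x s" "y s" "D y s"]
      by (simp add: rhs_def L_def mult_ac)
  qed
  have int: "set_integrable lborel {0..t} (\<lambda>s. rhs x s - rhs y s)"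
    by (intro set_integral_diff(1) rhs_integrable x y t0)
  have "picard c x t - picard c y t = (LBINT s:{0..t}. rhs x s - rhs y s)"
    using T_pos t0 set_integral_diff(2)[OF drift_integrable[OF c x t0] drift_integrable[OF c y t0]]
    by (simp add: picard_def)
  then have "\<bar>picard c x t - picard c y t\<bar> \<le> \<bar>LBINT s:{0..t}. rhs x s - rhs y s\<bar>"
    by simp
  also have "\<dots> \<le> (LBINT s:{0..t}. \<bar>rhs x s - rhs y s\<bar>)"
    using set_integral_norm_bound[OF int] by simp
  also have "\<dots> \<le> (LBINT s:{0..t}. L * b * exp (rate * s))"
    by (intro set_integral_mono set_integrable_abs int diff set_integrable_continuous_compact)
      (auto intro!: continuous_intros)
  also have "\<dots> = L * b * ((exp (rate * t) - 1) / rate)"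
    using rate_pos t0 by (simp add: set_integral_exp)
  also have "\<dots> = L / rate * b * (exp (rate * t) - 1)"
    by simp
  also have "\<dots> \<le> 1 / 2 * b * (exp (rate * t) - 1)"
  proof (intro mult_right_mono b)
    show "L / rate \<le> 1 / 2"
      using L by (simp add: rate_def L_def[symmetric])
    show "0 \<le> exp (rate * t) - 1"
      using rate_pos t0 by simp
  qed
  also have "\<dots> \<le> b / 2 * exp (rate * t)"
    using b by (simp add: algebra_simps)
  finally show ?thesis .
qed

lemma iterate_in_paths:
  assumes "c \<in> controls" "x \<in> paths T \<eta>"
  shows "(picard c ^^ m) x \<in> paths T \<eta>"
  using assms by (induction m) (auto intro: picard_in_paths)

text \<open>The initial distance is finite on a compact interval and is halved by each step in the
  weighted norm. With a fixed point as one of the two starting paths this gives convergence; with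
  \<open>picard c z\<close> and \<open>z\<close> it gives summable increments.\<close>

lemma iterates_contract:
  assumes c: "c \<in> controls" and x: "x \<in> paths T \<eta>" and y: "y \<in> paths T \<eta>"
  obtains b where "\<And>m t. t \<in> {0..R} \<Longrightarrow>
    \<bar>(picard c ^^ m) x t - (picard c ^^ m) y t\<bar> \<le> b * (1 / 2) ^ m"
proof -
  have "continuous_on {0..R} (\<lambda>t. x t - y t)"
    by (intro continuous_on_diff continuous_on_subset[OF paths_cont[OF x]]
        continuous_on_subset[OF paths_cont[OF y]]) auto
  then have "bounded ((\<lambda>t. x t - y t) ` {0..R})"
    by (intro compact_imp_bounded compact_continuous_image) auto
  then obtain B where B: "B > 0" "\<And>t. t \<in> {0..R} \<Longrightarrow> \<bar>x t - y t\<bar> \<le> B"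
    by (auto simp: bounded_pos)
  have step: "\<bar>(picard c ^^ m) x t - (picard c ^^ m) y t\<bar> \<le> B * (1 / 2) ^ m * exp (rate * t)"
    if "t \<in> {0..R}" for m t
    using that
  proof (induction m arbitrary: t)
    case 0
    have "B * 1 \<le> B * exp (rate * t)"
      using B(1) 0 rate_pos by (intro mult_left_mono) auto
    then show ?case using B(2)[OF 0] by simp
  next
    case (Suc m)
    show ?case
      using picard_contraction[OF c iterate_in_paths[OF c x] iterate_in_paths[OF c y] _ Suc.IH Suc.prems] B(1)
      by (simp add: mult_ac)
  qed
  have "\<bar>(picard c ^^ m) x t - (picard c ^^ m) y t\<bar> \<le> B * exp (rate * R) * (1 / 2) ^ m"
    if t: "t \<in> {0..R}" for m t
  proof -
    have "B * (1 / 2) ^ m * exp (rate * t) \<le> B * (1 / 2) ^ m * exp (rate * R)"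
      using B(1) t rate_pos by (intro mult_left_mono) auto
    with step[OF t, of m] show ?thesis by (simp add: mult_ac)
  qed
  then show ?thesis by (rule that)
qed

lemma iterates_tendsto_fixed_point:
  assumes c: "c \<in> controls" and x: "x \<in> paths T \<eta>" and w: "w \<in> paths T \<eta>" "picard c w = w"
    and t: "t \<ge> 0"
  shows "(\<lambda>m. (picard c ^^ m) x t) \<longlonglongrightarrow> w t"
proof -
  have fixed: "(picard c ^^ m) w = w" for m
    using w(2) by (induction m) auto
  obtain b where b: "\<And>m s. s \<in> {0..t} \<Longrightarrow>
      \<bar>(picard c ^^ m) x s - (picard c ^^ m) w s\<bar> \<le> b * (1 / 2) ^ m"
    using iterates_contract[OF c x w(1)] by blast
  have "(\<lambda>m. b * (1 / 2) ^ m) \<longlonglongrightarrow> b * 0"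
    by (intro tendsto_intros) auto
  then have lim: "(\<lambda>m. b * (1 / 2) ^ m) \<longlonglongrightarrow> 0"
    by simp
  have "norm ((picard c ^^ m) x t - w t) \<le> b * (1 / 2) ^ m" for m
    using b[of t m] t unfolding fixed by simp
  then have "(\<lambda>m. (picard c ^^ m) x t - w t) \<longlonglongrightarrow> 0"
    by (intro Lim_null_comparison[OF always_eventually lim]) blast
  then show ?thesis by (simp add: LIM_zero_iff)
qed

text \<open>Instead of completeness of a function space, the limit is written as a telescoping
  series of increments, which converges uniformly on bounded intervals by the Weierstrass test. The
  limit is therefore a path again.\<close>

lemma fixed_point_exists:
  assumes c: "c \<in> controls"
  obtains w where "w \<in> paths T \<eta>" "picard c w = w"
proof -
  define z where "z t = (if t < - T then 0 else if t < 0 then snd \<eta> t else 0)" for t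
  have "continuous_on {0..} z"
    by (rule continuous_on_eq[OF continuous_on_const[of _ 0]]) (auto simp: z_def)
  then have z: "z \<in> paths T \<eta>"
    by (auto simp: paths_def z_def)
  define X where "X m = (picard c ^^ m) z" for m
  have X: "X m \<in> paths T \<eta>" for m
    unfolding X_def by (rule iterate_in_paths[OF c z])
  define w where "w t = z t + (\<Sum>i. X (Suc i) t - X i t)" for t
  have sum: "(\<Sum>i<m. X (Suc i) t - X i t) = X m t - z t" for m t
    by (subst sum_lessThan_telescope) (simp add: X_def)
  have unif: "uniform_limit {0..R} X w sequentially" for R
  proof -
    obtain b where b: "\<And>m t. t \<in> {0..R} \<Longrightarrow>
        \<bar>(picard c ^^ m) (picard c z) t - (picard c ^^ m) z t\<bar> \<le> b * (1 / 2) ^ m"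
      using iterates_contract[OF c picard_in_paths[OF c z] z] by blast
    have "uniform_limit {0..R} (\<lambda>m t. \<Sum>i<m. X (Suc i) t - X i t)
        (\<lambda>t. \<Sum>i. X (Suc i) t - X i t) sequentially"
    proof (rule Weierstrass_m_test)
      show "norm (X (Suc i) t - X i t) \<le> b * (1 / 2) ^ i" if "t \<in> {0..R}" for i t
        using b[OF that, of i] by (simp add: X_def funpow_swap1)
      show "summable (\<lambda>i. b * (1 / 2) ^ i)"
        by (intro summable_mult summable_geometric) auto
    qed
    from uniform_limit_add[OF uniform_limit_const[of z "{0..R}" sequentially] this]
    show ?thesis by (simp add: sum w_def[abs_def])
  qed
  have "continuous_on {0..R} w" for R
    by (rule uniform_limit_theorem[OF _ unif])
      (auto intro!: always_eventually continuous_on_subset[OF paths_cont[OF X]])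
  then have "continuous_on {0..} w"
    by (intro continuous_on_atLeast_real)
  moreover have "w t = z t" if "t < 0" for t
    using that paths_agree[OF X z] by (simp add: w_def)
  ultimately have w: "w \<in> paths T \<eta>"
    using z T_pos by (simp add: paths_def)
  have "picard c w t = w t" for t
  proof (cases "t < 0")
    case True
    then show ?thesis using paths_agree[OF picard_in_paths[OF c w] w] by simp
  next
    case False
    have lim: "(\<lambda>m. X m t) \<longlonglongrightarrow> w t"
      by (rule tendsto_uniform_limitI[OF unif[of t]]) (use False in auto)
    have "(\<lambda>m. X (Suc m) t) \<longlonglongrightarrow> picard c w t"
    proof (rule tendstoI)
      fix e :: real assume e: "e > 0"
      \<comment> \<open>The weight is at least 1, so a distance below \<open>d\<close> on [0, t]
        satisfies the weighted hypothesis, and the contraction turns it into \<open>e / 2\<close> at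
        time \<open>t\<close>.\<close>
      define d where "d = e * exp (- rate * t)"
      have d: "d > 0" using e by (simp add: d_def)
      have "\<forall>\<^sub>F m in sequentially. \<forall>s\<in>{0..t}. dist (X m s) (w s) < d"
        by (rule uniform_limitD[OF unif d])
      then show "\<forall>\<^sub>F m in sequentially. dist (X (Suc m) t) (picard c w t) < e"
      proof eventually_elim
        case (elim m)
        have "\<bar>picard c (X m) t - picard c w t\<bar> \<le> d / 2 * exp (rate * t)"
        proof (rule picard_contraction[OF c X w])
          fix s assume s: "s \<in> {0..t}"
          have "d * 1 \<le> d * exp (rate * s)"
            using d s rate_pos by (intro mult_left_mono) auto
          then show "\<bar>X m s - w s\<bar> \<le> d * exp (rate * s)"
            using elim s by (fastforce simp: dist_real_def)
        qed (use d False in auto)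
        also have "\<dots> = e / 2"
          by (simp add: d_def exp_minus)
        finally show ?case using e by (simp add: X_def dist_real_def)
      qed
    qed
    moreover have "(\<lambda>m. X (Suc m) t) \<longlonglongrightarrow> w t"
      using lim by (rule LIMSEQ_Suc)
    ultimately show ?thesis by (rule LIMSEQ_unique)
  qed
  then have "picard c w = w" by auto
  with w show ?thesis by (rule that)
qed

section \<open>Trajectories: well-posedness, comparison and concavity in the control\<close>

abbreviation traj :: "(real \<Rightarrow> real) \<Rightarrow> real \<Rightarrow> real" where
  "traj \<equiv> trajectory f0 T D \<eta>"

text \<open>Gives meaning to the definite description in \<open>trajectory\<close>. For uniqueness,
  the iterates started at one fixed point are constant, yet they converge to any other.\<close>

lemma trajectory_fixed_point:
  assumes c: "c \<in> controls"
  shows "traj c \<in> paths T \<eta>" "picard c (traj c) = traj c"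
proof -
  obtain w where w: "w \<in> paths T \<eta>" "picard c w = w"
    using fixed_point_exists[OF c] by blast
  have "y = w" if y: "is_trajectory f0 T D \<eta> c y" for y
  proof
    fix t
    have y': "y \<in> paths T \<eta>" "picard c y = y"
      using y is_trajectory_iff_fixed_point[OF c] by auto
    show "y t = w t"
    proof (cases "t < 0")
      case True
      then show ?thesis using paths_agree[OF y'(1) w(1)] by simp
    next
      case False
      have "(\<lambda>m. (picard c ^^ m) y t) \<longlonglongrightarrow> w t" "(\<lambda>m. (picard c ^^ m) y t) \<longlonglongrightarrow> y t"
        using iterates_tendsto_fixed_point[OF c y'(1)] w y' False by auto
      then show ?thesis using LIMSEQ_unique by blast
    qed
  qed
  moreover have "is_trajectory f0 T D \<eta> c w"
    using w is_trajectory_iff_fixed_point[OF c] by auto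
  ultimately have "traj c = w"
    unfolding trajectory_def by (intro the_equality)
  with w show "traj c \<in> paths T \<eta>" "picard c (traj c) = traj c" by auto
qed

text \<open>Monotonicity of \<open>f0\<close> in the capital is available for nonnegative arguments,
  hence the sign condition on the lower path. Its memory term is nonnegative almost everywhere,
  which is enough under the integral.\<close>

lemma picard_mono:
  assumes c: "c \<in> controls" and x: "x \<in> paths T \<eta>" and y: "y \<in> paths T \<eta>"
    and nonneg: "\<And>t. t \<ge> 0 \<Longrightarrow> x t \<ge> 0" and le: "\<And>t. t \<ge> 0 \<Longrightarrow> x t \<le> y t" and t: "t \<ge> 0"
  shows "picard c x t \<le> picard c y t"
proof -
  have "AE s in lborel. s \<ge> 0 \<longrightarrow> D x s \<ge> 0"
    by (rule D_nonneg[OF x]) (rule nonneg)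
  then have ae: "AE s\<in>{0..t} in lborel. rhs x s - c s \<le> rhs y s - c s"
  proof eventually_elim
    case (elim s)
    show ?case
    proof
      assume s: "s \<in> {0..t}"
      have "D x s \<le> D y s"
        using s le by (intro D_mono x y) auto
      moreover have "0 \<le> x s" "x s \<le> y s"
        using s nonneg le by auto
      ultimately show "rhs x s - c s \<le> rhs y s - c s"
        using elim s by (auto simp: rhs_def intro!: production_mono[OF production])
    qed
  qed
  have "(LBINT s:{0..t}. rhs x s - c s) \<le> (LBINT s:{0..t}. rhs y s - c s)"
    by (intro set_integral_mono_AE drift_integrable c x y t ae)
  then show ?thesis by (simp add: picard_def)
qed

text \<open>By monotonicity all Picard iterates of a subsolution stay above it, and they converge to
  the trajectory.\<close>

lemma trajectory_ge_subsolution: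
  assumes c: "c \<in> controls" and z: "z \<in> paths T \<eta>"
    and nonneg: "\<And>t. t \<ge> 0 \<Longrightarrow> z t \<ge> 0" and sub: "\<And>t. t \<ge> 0 \<Longrightarrow> z t \<le> picard c z t"
    and t: "t \<ge> 0"
  shows "z t \<le> traj c t"
proof -
  have "z t \<le> (picard c ^^ m) z t" if "t \<ge> 0" for m t
    using that
  proof (induction m arbitrary: t)
    case (Suc m)
    have "picard c z t \<le> picard c ((picard c ^^ m) z) t"
      using Suc by (intro picard_mono c z iterate_in_paths nonneg) auto
    then show ?case using sub[OF Suc.prems] by simp
  qed simp
  then show ?thesis
    using t iterates_tendsto_fixed_point[OF c z trajectory_fixed_point[OF c] t]
    by (intro LIMSEQ_le_const) auto
qed

text \<open>The mixture of two trajectories is a subsolution for the mixed control, because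
  \<open>f0\<close> is concave and the memory operator is affine.\<close>

lemma trajectory_concave:
  assumes b: "b \<in> controls" and c: "c \<in> controls"
    and pos: "\<And>t. t \<ge> 0 \<Longrightarrow> traj b t \<ge> 0" "\<And>t. t \<ge> 0 \<Longrightarrow> traj c t \<ge> 0"
    and u: "u \<ge> 0" "v \<ge> 0" "u + v = 1" and t: "t \<ge> 0"
  shows "u * traj b t + v * traj c t \<le> traj (\<lambda>t. u * b t + v * c t) t"
proof (rule trajectory_ge_subsolution[where z = "\<lambda>t. u * traj b t + v * traj c t", OF _ _ _ _ t])
  let ?x = "traj b" and ?y = "traj c"
  let ?z = "\<lambda>t. u * ?x t + v * ?y t" and ?e = "\<lambda>t. u * b t + v * c t"
  note x = trajectory_fixed_point[OF b] and y = trajectory_fixed_point[OF c]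
  show e: "?e \<in> controls" and z: "?z \<in> paths T \<eta>"
    using b c u x y by (auto intro: controls_convex paths_convex)
  show "0 \<le> ?z t" if "t \<ge> 0" for t
    using pos that u by simp
  show "?z t \<le> picard ?e ?z t" if t: "t \<ge> 0" for t
  proof -
    have "u * (LBINT s:{0..t}. rhs ?x s - b s) + v * (LBINT s:{0..t}. rhs ?y s - c s)
        = (LBINT s:{0..t}. u * (rhs ?x s - b s)) + (LBINT s:{0..t}. v * (rhs ?y s - c s))"
      by simp
    also have "\<dots> = (LBINT s:{0..t}. u * (rhs ?x s - b s) + v * (rhs ?y s - c s))"
      using x y b c t by (intro set_integral_add(2)[symmetric] set_integrable_mult_right drift_integrable)
    also have "\<dots> \<le> (LBINT s:{0..t}. rhs ?z s - ?e s)"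
    proof (intro set_integral_mono drift_integrable e z t set_integral_add(1) set_integrable_mult_right b c x y)
      fix s assume "s \<in> {0..t}"
      then have s: "s \<ge> 0" by simp
      show "u * (rhs ?x s - b s) + v * (rhs ?y s - c s) \<le> rhs ?z s - ?e s"
        using production_concave[OF production pos(1)[OF s] pos(2)[OF s] u, of "D ?x s" "D ?y s"]
          pos[OF s] u D_convex[OF x(1) y(1) u(3) s]
        by (simp add: rhs_def algebra_simps)
    qed
    finally have "u * (LBINT s:{0..t}. rhs ?x s - b s) + v * (LBINT s:{0..t}. rhs ?y s - c s)
        \<le> (LBINT s:{0..t}. rhs ?z s - ?e s)" .
    moreover have "u * fst \<eta> + v * fst \<eta> = fst \<eta>"
      using u by (simp add: distrib_right[symmetric])
    moreover have "u * snd \<eta> t + v * snd \<eta> t = snd \<eta> t"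
      using u by (simp add: distrib_right[symmetric])
    ultimately have "u * picard b ?x t + v * picard c ?y t \<le> picard ?e ?z t"
      using t by (simp add: picard_def algebra_simps)
    then show ?thesis by (simp only: x(2) y(2))
  qed
qed

text \<open>The path frozen at \<open>m\<close> is a subsolution: production is nonnegative along
  it, and consumption never removes more than \<open>fst \<eta> - m\<close>.\<close>

lemma trajectory_lower_bound:
  assumes c: "c \<in> controls" and m: "0 \<le> m" "m \<le> fst \<eta>"
    and total: "\<And>t. t \<ge> 0 \<Longrightarrow> (LBINT s:{0..t}. c s) \<le> fst \<eta> - m"
    and t: "t \<ge> 0"
  shows "m \<le> traj c t"
proof -
  define z where "z t = (if t < - T then 0 else if t < 0 then snd \<eta> t else m)" for t
  have "continuous_on {0..} z"
    by (rule continuous_on_eq[OF continuous_on_const[of _ m]]) (use T_pos in \<open>auto simp: z_def\<close>)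
  then have z: "z \<in> paths T \<eta>"
    by (auto simp: paths_def z_def)
  have z_nonneg: "t \<ge> 0 \<Longrightarrow> z t \<ge> 0" for t
    using m T_pos by (simp add: z_def)
  have "z t \<le> traj c t"
  proof (rule trajectory_ge_subsolution[OF c z z_nonneg _ t])
    fix t :: real assume t: "t \<ge> 0"
    have D_z: "AE s in lborel. s \<ge> 0 \<longrightarrow> D z s \<ge> 0"
      by (rule D_nonneg[OF z]) (rule z_nonneg)
    have "(LBINT s:{0..t}. 0) \<le> (LBINT s:{0..t}. rhs z s)"
    proof (rule set_integral_mono_AE)
      show "set_integrable lborel {0..t} (rhs z)"
        by (rule rhs_integrable[OF z t])
      show "AE s\<in>{0..t} in lborel. 0 \<le> rhs z s"
        using D_z
        by eventually_elim (auto simp: rhs_def intro!: production_nonneg[OF production])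
    qed (simp add: set_integrable_def)
    then have "(LBINT s:{0..t}. rhs z s - c s) \<ge> - (fst \<eta> - m)"
      using total[OF t] by (simp add: set_integral_diff(2) rhs_integrable[OF z t] controls_integrable[OF c t])
    then show "z t \<le> picard c z t"
      using t T_pos by (simp add: picard_def z_def)
  qed
  then show ?thesis using t T_pos by (simp add: z_def)
qed

end

section \<open>The pointwise and the distributed delay\<close>

text \<open>Glues the history, measurable as an L^2 datum, to the continuous future. Measurability
  on the whole line is what shifts and parametrised integrals require.\<close>

lemma paths_borel_measurable:
  assumes \<eta>: "\<eta> \<in> H_pp T" and x: "x \<in> paths T \<eta>"
  shows "x \<in> borel_measurable borel"
proof -
  have [measurable]: "(\<lambda>t. indicator {-T..0} t * snd \<eta> t) \<in> borel_measurable borel"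
    using \<eta> by (auto simp: H_pp_def L2_def set_borel_measurable_def)
  have [measurable]: "(\<lambda>t. indicator {0..} t *\<^sub>R x t) \<in> borel_measurable borel"
    by (intro borel_measurable_continuous_on_indicator paths_cont[OF x]) auto
  have "(\<lambda>t. indicator {-T..<0} t * (indicator {-T..0} t * snd \<eta> t) + indicator {0..} t *\<^sub>R x t)
      \<in> borel_measurable borel"
    by measurable
  also have "(\<lambda>t. indicator {-T..<0} t * (indicator {-T..0} t * snd \<eta> t) + indicator {0..} t *\<^sub>R x t) = x"
  proof
    fix t
    consider "t < - T" "t < 0" | "t \<in> {-T..<0}" | "t < - T" "t \<ge> 0" | "t \<ge> 0" "t \<ge> - T" by force
    then show "indicator {-T..<0} t * (indicator {-T..0} t * snd \<eta> t) + indicator {0..} t *\<^sub>R x t = x t"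
      using x by cases (auto simp: paths_def)
  qed
  finally show ?thesis .
qed

lemma paths_history_integrable:
  assumes \<eta>: "\<eta> \<in> H_pp T" and x: "x \<in> paths T \<eta>"
  shows "set_integrable lborel {-T..t} x"
proof -
  have "set_integrable lborel {-T..0} (snd \<eta>)"
    using \<eta> by (intro L2_set_integrable) (auto simp: H_pp_def)
  then have "set_integrable lborel {-T..<0} (snd \<eta>)"
    by (rule set_integrable_subset) auto
  also have "?this \<longleftrightarrow> set_integrable lborel {-T..<0} x"
    using x by (intro set_integrable_cong) (auto simp: paths_def)
  finally have "set_integrable lborel ({-T..<0} \<union> {0..t}) x"
    by (intro set_integrable_Un paths_set_integrable[OF x]) auto
  then show ?thesis
    by (rule set_integrable_subset) auto
qed

text \<open>The exceptional null set comes from the initial history; null sets are translation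
  invariant, so the shifted path inherits the sign.\<close>

lemma paths_nonneg_AE:
  assumes \<eta>: "\<eta> \<in> H_pp T" and x: "x \<in> paths T \<eta>" and nonneg: "\<And>s. s \<ge> 0 \<Longrightarrow> x s \<ge> 0"
  shows "AE s in lborel. x (t + s) \<ge> 0"
proof -
  have "AE s in lborel. s \<in> {-T..0} \<longrightarrow> snd \<eta> s \<ge> 0"
    using \<eta> by (simp add: H_pp_def)
  then have "AE s in lborel. x s \<ge> 0"
  proof eventually_elim
    case (elim s)
    then show ?case
      using x nonneg[of s] by (cases "s < - T"; cases "s < 0") (auto simp: paths_def)
  qed
  moreover have "Measurable.pred borel (\<lambda>s. x s \<ge> 0)"
    using paths_borel_measurable[OF \<eta> x] by measurable
  ultimately show ?thesis
    using AE_borel_affine[of 1 "\<lambda>s. x s \<ge> 0" t] by simp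
qed

lemma paths_shift_integrable:
  assumes \<eta>: "\<eta> \<in> H_pp T" and x: "x \<in> paths T \<eta>"
  shows "set_integrable lborel {- T - t..r} (\<lambda>s. x (t + s))"
proof -
  have "integrable lborel (\<lambda>s. indicator {-T..t + r} (t + 1 * s) *\<^sub>R x (t + 1 * s))"
    using paths_history_integrable[OF \<eta> x, of "t + r"] unfolding set_integrable_def
    by (rule lborel_integrable_real_affine) simp
  also have "(\<lambda>s. indicator {-T..t + r} (t + 1 * s) *\<^sub>R x (t + 1 * s))
      = (\<lambda>s. indicator {- T - t..r} s *\<^sub>R x (t + s))"
    by (auto simp: indicator_def fun_eq_iff)
  finally show ?thesis by (simp add: set_integrable_def)
qed

text \<open>The time \<open>t - T / 2\<close> lies either in the history shared by all paths or in
  [0, t]; hence the Lipschitz constant 1.\<close>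

lemma delayed_equation_pointwise:
  assumes T: "T > 0" and pf: "production_function f0 C" and \<eta>: "\<eta> \<in> H_pp T"
  shows "delayed_equation f0 C T \<eta> (pointwise_delay T) 1"
proof
  show "production_function f0 C" "T > 0" "fst \<eta> > 0" "(0::real) \<le> 1"
    using assms by (auto simp: H_pp_def)
next
  fix x t assume x: "x \<in> paths T \<eta>" and "(t::real) \<ge> 0"
  have "set_integrable lborel {0..t} (\<lambda>s. x (- T / 2 + s))"
    by (rule set_integrable_subset[OF paths_shift_integrable[OF \<eta> x, of "- T / 2" t]]) (use T in auto)
  then show "set_integrable lborel {0..t} (pointwise_delay T x)"
    by (simp add: pointwise_delay_def[abs_def] add.commute)
next
  fix x y t b assume x: "x \<in> paths T \<eta>" and y: "y \<in> paths T \<eta>" and t: "(t::real) \<ge> 0"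
    and b: "\<And>s. s \<in> {0..t} \<Longrightarrow> \<bar>x s - y s\<bar> \<le> b"
  show "\<bar>pointwise_delay T x t - pointwise_delay T y t\<bar> \<le> 1 * b"
  proof (cases "t - T / 2 < 0")
    case True
    then show ?thesis
      using paths_agree[OF x y] b[of 0] t by (simp add: pointwise_delay_def)
  next
    case False
    then show ?thesis
      using b[of "t - T / 2"] T by (simp add: pointwise_delay_def)
  qed
next
  fix x y t assume x: "x \<in> paths T \<eta>" and y: "y \<in> paths T \<eta>" and t: "(t::real) \<ge> 0"
    and le: "\<And>s. s \<in> {0..t} \<Longrightarrow> x s \<le> y s"
  show "pointwise_delay T x t \<le> pointwise_delay T y t"
    using paths_agree[OF x y, of "t - T / 2"] le[of "t - T / 2"] T
    by (cases "t - T / 2 < 0") (auto simp: pointwise_delay_def)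
next
  fix x assume x: "x \<in> paths T \<eta>" and nonneg: "\<And>s. s \<ge> 0 \<Longrightarrow> x s \<ge> 0"
  show "AE s in lborel. s \<ge> 0 \<longrightarrow> pointwise_delay T x s \<ge> 0"
    using paths_nonneg_AE[OF \<eta> x nonneg, of "- T / 2"]
    by (auto simp: pointwise_delay_def add.commute)
qed (simp add: pointwise_delay_def)

text \<open>The kernel is bounded on its support interval, so the shifted path times that bound
  dominates the product.\<close>

lemma distributed_delay_integrable:
  assumes \<eta>: "\<eta> \<in> H_pp T" and x: "x \<in> paths T \<eta>" and t: "t \<ge> 0"
    and a: "a \<in> W12 T" "set_integrable lborel {-T..0} a"
  shows "set_integrable lborel {-T..0} (\<lambda>\<xi>. a \<xi> * x (t + \<xi>))"
proof -
  obtain K where K: "K \<ge> 0" "\<And>\<xi>. \<xi> \<in> {-T..0} \<Longrightarrow> \<bar>a \<xi>\<bar> \<le> K"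
    using W12_bounded[OF a(1)] by blast
  have x_int: "set_integrable lborel {-T..0} (\<lambda>\<xi>. x (t + \<xi>))"
    by (rule set_integrable_subset[OF paths_shift_integrable[OF \<eta> x, of t 0]]) (use t in auto)
  have [measurable]: "(\<lambda>\<xi>. indicator {-T..0} \<xi> * a \<xi>) \<in> borel_measurable lborel"
    "(\<lambda>\<xi>. indicator {-T..0} \<xi> * x (t + \<xi>)) \<in> borel_measurable lborel"
    using a(2) x_int by (auto simp: set_integrable_def)
  show ?thesis
  proof (rule set_integrable_bound)
    show "set_integrable lborel {-T..0} (\<lambda>\<xi>. K * x (t + \<xi>))"
      using x_int by (rule set_integrable_mult_right)
    have "(\<lambda>\<xi>. (indicator {-T..0} \<xi> * a \<xi>) * (indicator {-T..0} \<xi> * x (t + \<xi>))) \<in> borel_measurable lborel"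
      by measurable
    also have "(\<lambda>\<xi>. (indicator {-T..0} \<xi> * a \<xi>) * (indicator {-T..0} \<xi> * x (t + \<xi>)))
        = (\<lambda>\<xi>. indicator {-T..0} \<xi> *\<^sub>R (a \<xi> * x (t + \<xi>)))"
      by (auto simp: indicator_def)
    finally show "set_borel_measurable lborel {-T..0} (\<lambda>\<xi>. a \<xi> * x (t + \<xi>))"
      by (simp add: set_borel_measurable_def)
    show "AE \<xi> in lborel. \<xi> \<in> {-T..0} \<longrightarrow> norm (a \<xi> * x (t + \<xi>)) \<le> norm (K * x (t + \<xi>))"
      using K by (auto simp: abs_mult intro!: mult_right_mono)
  qed
qed

text \<open>The Lipschitz constant is the L^1 norm of the kernel, which equals its integral by
  nonnegativity; nonnegativity also makes the memory operator order preserving.\<close>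

lemma delayed_equation_distributed:
  assumes T: "T > 0" and pf: "production_function f0 C" and \<eta>: "\<eta> \<in> H_pp T"
    and a: "a \<in> W12 T" "set_integrable lborel {-T..0} a" and a_nonneg: "\<And>\<xi>. \<xi> \<in> {-T..0} \<Longrightarrow> a \<xi> \<ge> 0"
  shows "delayed_equation f0 C T \<eta> (distributed_delay T a) (LBINT \<xi>:{-T..0}. a \<xi>)"
proof
  show "production_function f0 C" "T > 0" "fst \<eta> > 0"
    using assms by (auto simp: H_pp_def)
  show "0 \<le> (LBINT \<xi>:{-T..0}. a \<xi>)"
    unfolding set_lebesgue_integral_def
    by (rule Bochner_Integration.integral_nonneg) (auto simp: indicator_def a_nonneg)
next
  fix x t assume x: "x \<in> paths T \<eta>" and t: "(t::real) \<ge> 0"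
  note [measurable] = paths_borel_measurable[OF \<eta> x]
  have [measurable]: "(\<lambda>\<xi>. indicator {-T..0} \<xi> * a \<xi>) \<in> borel_measurable borel"
    using a(2) by (auto simp: set_integrable_def)
  obtain K where K: "K \<ge> 0" "\<And>\<xi>. \<xi> \<in> {-T..0} \<Longrightarrow> \<bar>a \<xi>\<bar> \<le> K"
    using W12_bounded[OF a(1)] by blast
  define I where "I = (LBINT r:{-T..t}. \<bar>x r\<bar>)"
  have abs_int: "set_integrable lborel {-T..t} (\<lambda>r. \<bar>x r\<bar>)"
    by (intro set_integrable_abs paths_history_integrable[OF \<eta> x])
  show "set_integrable lborel {0..t} (distributed_delay T a x)"
  proof (rule set_integrable_bound)
    show "set_integrable lborel {0..t} (\<lambda>_. K * I)"
      by (rule set_integrable_continuous_compact) auto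
    \<comment> \<open>The integrand is jointly measurable, so the integral depends measurably on the
      parameter \<open>s\<close>.\<close>
    have "(\<lambda>s. \<integral>\<xi>. (indicator {-T..0} \<xi> * a \<xi>) * x (s + \<xi>) \<partial>lborel) \<in> borel_measurable lborel"
      by measurable
    also have "(\<lambda>s. \<integral>\<xi>. (indicator {-T..0} \<xi> * a \<xi>) * x (s + \<xi>) \<partial>lborel) = distributed_delay T a x"
      by (simp add: distributed_delay_def[abs_def] set_lebesgue_integral_def mult.assoc)
    finally show "set_borel_measurable lborel {0..t} (distributed_delay T a x)"
      by (simp add: set_borel_measurable_def)
    show "AE s in lborel. s \<in> {0..t} \<longrightarrow> norm (distributed_delay T a x s) \<le> norm (K * I)"
    proof (intro AE_I2 impI)
      fix s assume s: "s \<in> {0..t}"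
      have x_int: "set_integrable lborel {-T..0} (\<lambda>\<xi>. x (s + \<xi>))"
        by (rule set_integrable_subset[OF paths_shift_integrable[OF \<eta> x, of s 0]]) (use s in auto)
      have int: "set_integrable lborel {-T..0} (\<lambda>\<xi>. a \<xi> * x (s + \<xi>))"
        by (rule distributed_delay_integrable[OF \<eta> x _ a]) (use s in auto)
      have "\<bar>distributed_delay T a x s\<bar> \<le> (LBINT \<xi>:{-T..0}. \<bar>a \<xi> * x (s + \<xi>)\<bar>)"
        using set_integral_norm_bound[OF int] by (simp add: distributed_delay_def)
      also have "\<dots> \<le> (LBINT \<xi>:{-T..0}. K * \<bar>x (s + \<xi>)\<bar>)"
        by (intro set_integral_mono set_integrable_abs set_integrable_mult_right int x_int)
          (use K in \<open>auto simp: abs_mult intro!: mult_right_mono\<close>)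
      also have "\<dots> = K * (LBINT \<xi>:{-T..0}. \<bar>x (s + \<xi>)\<bar>)"
        by simp
      also have "(LBINT \<xi>:{-T..0}. \<bar>x (s + \<xi>)\<bar>) \<le> I"
      proof -
        \<comment> \<open>Translation by \<open>s\<close> moves the window [-T, 0] into [-T, t], so
          \<open>I\<close> bounds the integral for every \<open>s\<close> at once.\<close>
        have "I = (\<integral>r. indicator {-T..t} (s + 1 * r) *\<^sub>R \<bar>x (s + 1 * r)\<bar> \<partial>lborel)"
          using lborel_integral_real_affine[of 1 "\<lambda>r. indicator {-T..t} r *\<^sub>R \<bar>x r\<bar>" s]
          by (simp add: I_def set_lebesgue_integral_def)
        moreover have "integrable lborel (\<lambda>r. indicator {-T..t} (s + 1 * r) *\<^sub>R \<bar>x (s + 1 * r)\<bar>)"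
          using abs_int unfolding set_integrable_def by (rule lborel_integrable_real_affine) simp
        ultimately show ?thesis
          unfolding set_lebesgue_integral_def
          by (simp only:) (rule integral_mono,
              use set_integrable_abs[OF x_int] s in \<open>auto simp: set_integrable_def split: split_indicator\<close>)
      qed
      finally show "norm (distributed_delay T a x s) \<le> norm (K * I)"
        using K(1) by (simp add: mult_left_mono)
    qed
  qed
next
  fix x y t b assume x: "x \<in> paths T \<eta>" and y: "y \<in> paths T \<eta>" and t: "(t::real) \<ge> 0"
    and b: "\<And>s. s \<in> {0..t} \<Longrightarrow> \<bar>x s - y s\<bar> \<le> b"
  note ix = distributed_delay_integrable[OF \<eta> x t a] and iy = distributed_delay_integrable[OF \<eta> y t a]
  have close: "\<bar>x (t + \<xi>) - y (t + \<xi>)\<bar> \<le> b" if "\<xi> \<in> {-T..0}" for \<xi>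
    using that b[of "t + \<xi>"] b[of 0] t paths_agree[OF x y, of "t + \<xi>"]
    by (cases "t + \<xi> < 0") auto
  have "distributed_delay T a x t - distributed_delay T a y t
      = (LBINT \<xi>:{-T..0}. a \<xi> * x (t + \<xi>) - a \<xi> * y (t + \<xi>))"
    by (simp add: distributed_delay_def set_integral_diff(2)[OF ix iy])
  also have "\<bar>\<dots>\<bar> \<le> (LBINT \<xi>:{-T..0}. \<bar>a \<xi> * x (t + \<xi>) - a \<xi> * y (t + \<xi>)\<bar>)"
    using set_integral_norm_bound[OF set_integral_diff(1)[OF ix iy]] by simp
  also have "\<dots> \<le> (LBINT \<xi>:{-T..0}. a \<xi> * b)"
  proof (intro set_integral_mono set_integrable_abs set_integral_diff(1) ix iy set_integrable_mult_left a)
    fix \<xi> assume \<xi>: "\<xi> \<in> {-T..0}"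
    show "\<bar>a \<xi> * x (t + \<xi>) - a \<xi> * y (t + \<xi>)\<bar> \<le> a \<xi> * b"
      using mult_left_mono[OF close[OF \<xi>] a_nonneg[OF \<xi>]] a_nonneg[OF \<xi>]
      by (simp add: right_diff_distrib[symmetric] abs_mult)
  qed
  finally show "\<bar>distributed_delay T a x t - distributed_delay T a y t\<bar> \<le> (LBINT \<xi>:{-T..0}. a \<xi>) * b"
    by simp
next
  fix x y t assume x: "x \<in> paths T \<eta>" and y: "y \<in> paths T \<eta>" and t: "(t::real) \<ge> 0"
    and le: "\<And>s. s \<in> {0..t} \<Longrightarrow> x s \<le> y s"
  have "x (t + \<xi>) \<le> y (t + \<xi>)" if "\<xi> \<in> {-T..0}" for \<xi>
    using that le[of "t + \<xi>"] t paths_agree[OF x y, of "t + \<xi>"] by (cases "t + \<xi> < 0") auto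
  then show "distributed_delay T a x t \<le> distributed_delay T a y t"
    unfolding distributed_delay_def
    by (intro set_integral_mono distributed_delay_integrable[OF \<eta> x t a]
        distributed_delay_integrable[OF \<eta> y t a] mult_left_mono a_nonneg)
next
  fix x y u v t assume x: "x \<in> paths T \<eta>" and y: "y \<in> paths T \<eta>" and t: "(t::real) \<ge> 0"
  have "distributed_delay T a (\<lambda>s. u * x s + v * y s) t
      = (LBINT \<xi>:{-T..0}. u * (a \<xi> * x (t + \<xi>)) + v * (a \<xi> * y (t + \<xi>)))"
    by (simp add: distributed_delay_def algebra_simps)
  also have "\<dots> = (LBINT \<xi>:{-T..0}. u * (a \<xi> * x (t + \<xi>))) + (LBINT \<xi>:{-T..0}. v * (a \<xi> * y (t + \<xi>)))"
    by (intro set_integral_add(2) set_integrable_mult_right distributed_delay_integrable[OF \<eta> x t a]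
        distributed_delay_integrable[OF \<eta> y t a])
  finally show "distributed_delay T a (\<lambda>s. u * x s + v * y s) t
      = u * distributed_delay T a x t + v * distributed_delay T a y t"
    by (simp add: distributed_delay_def)
next
  fix x assume x: "x \<in> paths T \<eta>" and nonneg: "\<And>s. s \<ge> 0 \<Longrightarrow> x s \<ge> 0"
  have "distributed_delay T a x t \<ge> 0" for t
  proof -
    have "AE \<xi> in lborel. x (t + \<xi>) \<ge> 0"
      by (rule paths_nonneg_AE[OF \<eta> x]) (rule nonneg)
    then have "AE \<xi> in lborel. indicator {-T..0} \<xi> *\<^sub>R (a \<xi> * x (t + \<xi>)) \<ge> 0"
      by eventually_elim (auto simp: indicator_def intro!: mult_nonneg_nonneg a_nonneg)
    then show ?thesis
      unfolding distributed_delay_def set_lebesgue_integral_def by (rule integral_nonneg_AE)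
  qed
  then show "AE s in lborel. s \<ge> 0 \<longrightarrow> distributed_delay T a x s \<ge> 0"
    by simp
qed

section \<open>Consumption utility and value functions\<close>

lemma has_bochner_integral_exp_tail:
  fixes \<rho> m :: real
  assumes "\<rho> > 0"
  shows "has_bochner_integral lborel (\<lambda>t. indicator {m..} t * exp (- \<rho> * t)) (exp (- \<rho> * m) / \<rho>)"
proof (rule has_bochner_integral_nn_integral)
  have "((\<lambda>t. - exp (- \<rho> * t) / \<rho>) \<longlongrightarrow> - 0 / \<rho>) at_top"
    using assms
    by (intro tendsto_intros filterlim_compose[OF exp_at_bot] filterlim_tendsto_neg_mult_at_bot[OF tendsto_const])
      (auto intro: filterlim_ident)
  then have "(\<integral>\<^sup>+t. ennreal (exp (- \<rho> * t)) * indicator {m..} t \<partial>lborel) = ennreal (- 0 / \<rho> - (- exp (- \<rho> * m) / \<rho>))"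
    by (intro nn_integral_FTC_atLeast) (use assms in \<open>auto intro!: derivative_eq_intros\<close>)
  moreover have "(\<integral>\<^sup>+t. ennreal (indicator {m..} t * exp (- \<rho> * t)) \<partial>lborel)
      = (\<integral>\<^sup>+t. ennreal (exp (- \<rho> * t)) * indicator {m..} t \<partial>lborel)"
    by (intro nn_integral_cong) (auto simp: indicator_def)
  ultimately show "(\<integral>\<^sup>+t. ennreal (indicator {m..} t * exp (- \<rho> * t)) \<partial>lborel) = ennreal (exp (- \<rho> * m) / \<rho>)"
    by simp
qed (use assms in auto)

lemma set_integrable_exp_tail:
  fixes \<rho> m :: real
  assumes "\<rho> > 0"
  shows "set_integrable lborel {m..} (\<lambda>t. exp (- \<rho> * t))"
    and "(LBINT t:{m..}. exp (- \<rho> * t)) = exp (- \<rho> * m) / \<rho>"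
  using has_bochner_integral_exp_tail[OF assms, of m]
  by (auto simp: set_integrable_def set_lebesgue_integral_def has_bochner_integral_iff)

text \<open>Controls are only locally integrable; measurability on the half-line follows by
  exhausting it with bounded intervals.\<close>

lemma controls_borel_measurable:
  assumes "c \<in> controls"
  shows "(\<lambda>t. indicator {0..} t * c t) \<in> borel_measurable borel"
proof (rule borel_measurable_LIMSEQ_real)
  show "(\<lambda>t. indicator {0..real n} t * c t) \<in> borel_measurable borel" for n
    using controls_integrable[OF assms, of "real n"] by (auto simp: set_integrable_def)
  show "(\<lambda>n. indicator {0..real n} t * c t) \<longlonglongrightarrow> indicator {0..} t * c t" for t
  proof (rule tendsto_eventually)
    show "\<forall>\<^sub>F n in sequentially. indicator {0..real n} t * c t = indicator {0..} t * c t"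
      using eventually_ge_at_top[of "nat \<lceil>t\<rceil>"]
      by eventually_elim (auto simp: indicator_def)
  qed
qed

text \<open>A real-valued form of the objective without state utility. It does not involve the state
  equation, so its values can be carried from one delay problem to another.\<close>

definition discounted_utility :: "real \<Rightarrow> (real \<Rightarrow> real) \<Rightarrow> (real \<Rightarrow> real) \<Rightarrow> real" where
  "discounted_utility \<rho> U c = (LBINT t:{0..}. exp (- \<rho> * t) * U (c t))"

section \<open>Pure consumption utility and the cost of modifying a control\<close>

locale discounted_consumption =
  fixes \<rho> :: real and U1 :: "real \<Rightarrow> real" and B :: real
  assumes rho_pos: "\<rho> > 0"
    and utility: "consumption_utility U1"
    and B_pos: "B > 0"
    and utility_bound: "\<And>x. x \<ge> 0 \<Longrightarrow> \<bar>U1 x\<bar> \<le> B"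
begin

abbreviation J :: "(real \<Rightarrow> real) \<Rightarrow> real" where
  "J \<equiv> discounted_utility \<rho> U1"

text \<open>\<open>2 * B\<close> bounds the oscillation of \<open>U1\<close>, so this bounds the
  difference of any two discounted utilities; all losses are measured in this unit.\<close>

abbreviation W :: real where
  "W \<equiv> 2 * B / \<rho>"

lemma W_pos: "W > 0"
  using B_pos rho_pos by simp

lemma utility_deriv: "x > 0 \<Longrightarrow> (U1 has_real_derivative deriv U1 x) (at x)"
  using utility by (simp add: consumption_utility_def DERIV_deriv_iff_real_differentiable)

lemma utility_cont: "continuous_on {0..} U1"
  using utility by (simp add: consumption_utility_def)

lemma utility_mono:
  assumes "0 \<le> x" "x \<le> y"
  shows "U1 x \<le> U1 y"
proof (cases "x = y")
  case False
  have "U1 x < U1 y"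
  proof (rule DERIV_pos_imp_increasing_open[of x y U1])
    show "x < y" using assms False by simp
    show "\<exists>d. DERIV U1 z :> d \<and> d > 0" if "x < z" "z < y" for z
      using that assms utility utility_deriv[of z] unfolding consumption_utility_def
      by (intro exI[of _ "deriv U1 z"]) simp
    show "continuous_on {x..y} U1"
      using assms by (intro continuous_on_subset[OF utility_cont]) auto
  qed
  then show ?thesis by simp
qed simp

text \<open>The second derivative gives concavity on the open half-line; shifting both points by
  \<open>e n\<close> and using continuity includes the boundary point 0.\<close>

lemma utility_concave:
  assumes xy: "x \<ge> 0" "y \<ge> 0" and uv: "u \<ge> 0" "v \<ge> 0" "u + v = 1"
  shows "u * U1 x + v * U1 y \<le> U1 (u * x + v * y)"
proof -
  have concave: "concave_on {0<..} U1"
  proof (rule f''_le0_imp_concave)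
    show "(U1 has_real_derivative deriv U1 x) (at x)" if "x \<in> {0<..}" for x
      using that by (auto intro: utility_deriv)
    show "(deriv U1 has_real_derivative deriv (deriv U1) x) (at x)" if "x \<in> {0<..}" for x
      using utility that by (simp add: consumption_utility_def DERIV_deriv_iff_real_differentiable)
    show "deriv (deriv U1) x \<le> 0" if "x \<in> {0<..}" for x
      using utility that by (auto simp: consumption_utility_def intro: less_imp_le)
  qed simp
  define e where "e n = inverse (real (Suc n))" for n
  have e: "e n > 0" for n by (simp add: e_def)
  have lim: "(\<lambda>n. U1 (z + e n)) \<longlonglongrightarrow> U1 z" if z: "z \<ge> 0" for z
  proof (rule continuous_on_tendsto_compose[OF utility_cont])
    have "(\<lambda>n. z + e n) \<longlonglongrightarrow> z + 0"
      unfolding e_def by (intro tendsto_add tendsto_const LIMSEQ_inverse_real_of_nat)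
    then show "(\<lambda>n. z + e n) \<longlonglongrightarrow> z" by simp
    show "\<forall>\<^sub>F n in sequentially. z + e n \<in> {0..}"
      using z e by (simp add: add_nonneg_nonneg less_imp_le)
  qed (use z in auto)
  show ?thesis
  proof (rule LIMSEQ_le)
    show "(\<lambda>n. u * U1 (x + e n) + v * U1 (y + e n)) \<longlonglongrightarrow> u * U1 x + v * U1 y"
      by (intro tendsto_intros lim xy)
    show "(\<lambda>n. U1 (u * x + v * y + e n)) \<longlonglongrightarrow> U1 (u * x + v * y)"
      using xy uv by (intro lim) simp
    have "u * U1 (x + e n) + v * U1 (y + e n) \<le> U1 (u * x + v * y + e n)" for n
    proof -
      have "u * U1 (x + e n) + v * U1 (y + e n) \<le> U1 (u *\<^sub>R (x + e n) + v *\<^sub>R (y + e n))"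
        using concave uv xy e[of n] unfolding concave_on_iff by simp
      also have "u *\<^sub>R (x + e n) + v *\<^sub>R (y + e n) = u * x + v * y + (u + v) * e n"
        by (simp add: algebra_simps)
      finally show ?thesis using uv by simp
    qed
    then show "\<exists>N. \<forall>n\<ge>N. u * U1 (x + e n) + v * U1 (y + e n) \<le> U1 (u * x + v * y + e n)"
      by blast
  qed
qed

text \<open>The scaled point lies on the segment from \<open>x\<close> to 0, and the chord loses at
  most the fraction \<open>l\<close> of the oscillation.\<close>

lemma utility_scaled:
  assumes "x \<ge> 0" "0 \<le> l" "l \<le> 1"
  shows "U1 x - 2 * B * l \<le> U1 ((1 - l) * x)"
proof -
  have "(1 - l) * U1 x + l * U1 0 \<le> U1 ((1 - l) * x)"
    using utility_concave[of x 0 "1 - l" l] assms by simp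
  moreover have "l * (U1 x - U1 0) \<le> l * (2 * B)"
    using utility_bound[of x] utility_bound[of 0] assms by (intro mult_left_mono) auto
  ultimately show ?thesis by (simp add: algebra_simps)
qed

text \<open>The infinite slope at 0 lets \<open>U1\<close> dominate a line of any prescribed slope
  near 0, because \<open>U1 x - K * x\<close> is nondecreasing there.\<close>

lemma utility_steep_at_0:
  obtains z0 where "z0 > 0" "\<And>z. 0 \<le> z \<Longrightarrow> z \<le> z0 \<Longrightarrow> U1 0 + K * z \<le> U1 z"
proof -
  have "\<forall>\<^sub>F x in at_right 0. deriv U1 x \<ge> K"
    using utility by (auto simp: consumption_utility_def filterlim_at_top)
  then obtain z0 where z0: "z0 > 0" "\<And>x. 0 < x \<Longrightarrow> x < z0 \<Longrightarrow> deriv U1 x \<ge> K"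
    by (auto simp: eventually_at_right_field)
  have "U1 0 + K * z \<le> U1 z" if z: "0 \<le> z" "z \<le> z0" for z
  proof (cases "z = 0")
    case False
    have "U1 0 - K * 0 \<le> U1 z - K * z"
    proof (rule DERIV_nonneg_imp_increasing_open[of 0 z "\<lambda>x. U1 x - K * x"])
      show "\<exists>d. DERIV (\<lambda>x. U1 x - K * x) x :> d \<and> d \<ge> 0" if "0 < x" "x < z" for x
        using that z z0(2)[of x]
        by (intro exI[of _ "deriv U1 x - K"]) (auto intro!: derivative_eq_intros utility_deriv)
      show "continuous_on {0..z} (\<lambda>x. U1 x - K * x)"
        by (intro continuous_intros continuous_on_subset[OF utility_cont]) auto
    qed (use z in auto)
    then show ?thesis by simp
  qed simp
  with z0(1) show ?thesis by (rule that)
qed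

lemma discounted_integrable:
  assumes c: "c \<in> controls"
  shows "set_integrable lborel {0..} (\<lambda>t. exp (- \<rho> * t) * U1 (c t))"
proof (rule set_integrable_bound)
  show "set_integrable lborel {0..} (\<lambda>t. exp (- \<rho> * t) * B)"
    by (intro set_integrable_mult_left set_integrable_exp_tail rho_pos)
  note [measurable] = controls_borel_measurable[OF c]
  \<comment> \<open>\<open>U1\<close> is continuous only on [0, \<infinity>); composing with
    \<open>max 0\<close> extends it continuously without changing its values along a
    control.\<close>
  have [measurable]: "(\<lambda>x. U1 (max 0 x)) \<in> borel_measurable borel"
    by (intro borel_measurable_continuous_onI continuous_on_compose2[OF utility_cont] continuous_intros) auto
  have "(\<lambda>t. indicator {0..} t * (exp (- \<rho> * t) * U1 (max 0 (indicator {0..} t * c t)))) \<in> borel_measurable borel"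
    by measurable
  also have "(\<lambda>t. indicator {0..} t * (exp (- \<rho> * t) * U1 (max 0 (indicator {0..} t * c t))))
      = (\<lambda>t. indicator {0..} t *\<^sub>R (exp (- \<rho> * t) * U1 (c t)))"
    by (auto simp: indicator_def max_absorb2 controls_nonneg[OF c])
  finally show "set_borel_measurable lborel {0..} (\<lambda>t. exp (- \<rho> * t) * U1 (c t))"
    by (simp add: set_borel_measurable_def)
  show "AE t in lborel. t \<in> {0..} \<longrightarrow> norm (exp (- \<rho> * t) * U1 (c t)) \<le> norm (exp (- \<rho> * t) * B)"
    using B_pos by (auto simp: abs_mult intro!: mult_left_mono utility_bound controls_nonneg[OF c])
qed

lemma J_mono:
  assumes b: "b \<in> controls" and c: "c \<in> controls" and le: "\<And>t. t \<ge> 0 \<Longrightarrow> b t \<le> c t"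
  shows "J b \<le> J c"
  unfolding discounted_utility_def
  by (intro set_integral_mono discounted_integrable b c mult_left_mono utility_mono)
    (auto intro: le controls_nonneg[OF b])

lemma integral_exp_const: "(LBINT t:{0..}. exp (- \<rho> * t) * r) = r / \<rho>"
  using set_integrable_exp_tail(2)[OF rho_pos, of 0] by simp

lemma J_abs_le:
  assumes c: "c \<in> controls"
  shows "\<bar>J c\<bar> \<le> B / \<rho>"
proof -
  have "\<bar>J c\<bar> \<le> (LBINT t:{0..}. \<bar>exp (- \<rho> * t) * U1 (c t)\<bar>)"
    using set_integral_norm_bound[OF discounted_integrable[OF c]] by (simp add: discounted_utility_def)
  also have "\<dots> \<le> (LBINT t:{0..}. exp (- \<rho> * t) * B)"
    by (intro set_integral_mono set_integrable_abs discounted_integrable c set_integrable_mult_left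
        set_integrable_exp_tail rho_pos)
      (auto simp: abs_mult intro!: mult_left_mono utility_bound controls_nonneg[OF c])
  finally show ?thesis by (simp only: integral_exp_const)
qed

lemma J_scaled:
  assumes c: "c \<in> controls" and l: "0 \<le> l" "l \<le> 1"
  shows "J c - l * W \<le> J (\<lambda>t. (1 - l) * c t)"
proof -
  have c': "(\<lambda>t. (1 - l) * c t) \<in> controls"
    using controls_convex[OF c c, of "1 - l" 0] l by simp
  have "J c - l * W = (LBINT t:{0..}. exp (- \<rho> * t) * U1 (c t)) - (LBINT t:{0..}. exp (- \<rho> * t) * (2 * B * l))"
    by (simp only: integral_exp_const) (simp add: discounted_utility_def)
  also have "\<dots> = (LBINT t:{0..}. exp (- \<rho> * t) * U1 (c t) - exp (- \<rho> * t) * (2 * B * l))"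
    by (intro set_integral_diff(2)[symmetric] discounted_integrable c set_integrable_mult_left
        set_integrable_exp_tail rho_pos)
  also have "\<dots> \<le> J (\<lambda>t. (1 - l) * c t)"
    unfolding discounted_utility_def
  proof (intro set_integral_mono set_integral_diff(1) discounted_integrable c c' set_integrable_mult_left
        set_integrable_exp_tail rho_pos)
    fix t :: real assume "t \<in> {0..}"
    then have "U1 (c t) - 2 * B * l \<le> U1 ((1 - l) * c t)"
      by (intro utility_scaled l controls_nonneg[OF c]) simp
    then have "exp (- \<rho> * t) * (U1 (c t) - 2 * B * l) \<le> exp (- \<rho> * t) * U1 ((1 - l) * c t)"
      by (rule mult_left_mono) simp
    then show "exp (- \<rho> * t) * U1 (c t) - exp (- \<rho> * t) * (2 * B * l) \<le> exp (- \<rho> * t) * U1 ((1 - l) * c t)"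
      by (simp add: right_diff_distrib)
  qed
  finally show ?thesis .
qed

text \<open>The controls agree up to \<open>M\<close>, and afterwards the utilities differ by at
  most \<open>2 * B\<close>; the discounted tail supplies the exponential.\<close>

lemma J_stop_after:
  assumes c: "c \<in> controls" and s: "stop_after M c \<in> controls"
  shows "J (stop_after M c) \<le> J c" "J c \<le> J (stop_after M c) + W * exp (- \<rho> * M)"
proof -
  show "J (stop_after M c) \<le> J c"
    by (intro J_mono s c) (auto simp: stop_after_def controls_nonneg[OF c])
  have tail0: "set_integrable lborel {0..} (\<lambda>t. indicator {M..} t * exp (- \<rho> * t))"
  proof -
    \<comment> \<open>The stopping time may be negative, whereas the objective only sees times from
      0 on.\<close>
    have "set_integrable lborel {max 0 M..} (\<lambda>t. exp (- \<rho> * t))"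
      by (rule set_integrable_exp_tail[OF rho_pos])
    also have "?this \<longleftrightarrow> set_integrable lborel {0..} (\<lambda>t. indicator {M..} t * exp (- \<rho> * t))"
      unfolding set_integrable_def by (intro Bochner_Integration.integrable_cong) (auto simp: indicator_def)
    finally show ?thesis .
  qed
  then have tail: "set_integrable lborel {0..} (\<lambda>t. 2 * B * (indicator {M..} t * exp (- \<rho> * t)))"
    by (rule set_integrable_mult_right)
  have "J c \<le> (LBINT t:{0..}. exp (- \<rho> * t) * U1 (stop_after M c t) + 2 * B * (indicator {M..} t * exp (- \<rho> * t)))"
    unfolding discounted_utility_def
  proof (intro set_integral_mono set_integral_add(1) discounted_integrable c s tail)
    fix t :: real assume t: "t \<in> {0..}"
    have "U1 (c t) \<le> U1 (stop_after M c t) + 2 * B * indicator {M..} t"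
      using utility_bound[of "c t"] utility_bound[of 0] controls_nonneg[OF c, of t] t B_pos
      by (auto simp: stop_after_def indicator_def)
    then have "exp (- \<rho> * t) * U1 (c t) \<le> exp (- \<rho> * t) * (U1 (stop_after M c t) + 2 * B * indicator {M..} t)"
      by (rule mult_left_mono) simp
    then show "exp (- \<rho> * t) * U1 (c t)
        \<le> exp (- \<rho> * t) * U1 (stop_after M c t) + 2 * B * (indicator {M..} t * exp (- \<rho> * t))"
      by (simp add: algebra_simps)
  qed
  also have "\<dots> = J (stop_after M c) + 2 * B * (LBINT t:{0..}. indicator {M..} t * exp (- \<rho> * t))"
    unfolding set_integral_add(2)[OF discounted_integrable[OF s] tail]
    by (simp add: discounted_utility_def)
  also have "(LBINT t:{0..}. indicator {M..} t * exp (- \<rho> * t)) \<le> (LBINT t:{M..}. exp (- \<rho> * t))"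
    unfolding set_lebesgue_integral_def
  proof (rule integral_mono)
    show "integrable lborel (\<lambda>t. indicator {0..} t *\<^sub>R (indicator {M..} t * exp (- \<rho> * t)))"
      using tail0 by (simp add: set_integrable_def)
    show "integrable lborel (\<lambda>t. indicator {M..} t *\<^sub>R exp (- \<rho> * t))"
      using set_integrable_exp_tail(1)[OF rho_pos] by (simp add: set_integrable_def)
  qed (auto simp: indicator_def)
  also have "(LBINT t:{M..}. exp (- \<rho> * t)) = exp (- \<rho> * M) / \<rho>"
    by (rule set_integrable_exp_tail(2)[OF rho_pos])
  finally show "J c \<le> J (stop_after M c) + W * exp (- \<rho> * M)"
    using B_pos by (simp add: algebra_simps)
qed

lemma ext_integral_discounted:
  assumes c: "c \<in> controls" and U: "\<And>t. t \<ge> 0 \<Longrightarrow> g t = 0"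
  shows "ext_integral (\<lambda>t. exp (- \<rho> * t) * (U1 (c t) + g t)) = ereal (J c)"
proof -
  have "ext_integral (\<lambda>t. exp (- \<rho> * t) * (U1 (c t) + g t)) = ext_integral (\<lambda>t. exp (- \<rho> * t) * U1 (c t))"
    by (intro antisym ext_integral_mono) (auto simp: U)
  then show ?thesis
    by (simp only: ext_integral_eq_set_integral[OF discounted_integrable[OF c]] discounted_utility_def)
qed

end

section \<open>Admissible controls and value functions\<close>

locale delayed_control_problem = delayed_equation f0 C T \<eta> D A + discounted_consumption \<rho> U1 B
  for f0 C T \<eta> D A \<rho> U1 B
begin

abbreviation adm :: "(real \<Rightarrow> real) set" where
  "adm \<equiv> admissible f0 T D \<eta>"

abbreviation val :: "(real \<Rightarrow> real) \<Rightarrow> ereal" where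
  "val U \<equiv> value_fn f0 T D \<rho> U1 U \<eta>"

lemma adm_controls: "c \<in> adm \<Longrightarrow> c \<in> controls"
  by (simp add: admissible_def)

lemma adm_pos: "c \<in> adm \<Longrightarrow> t \<ge> 0 \<Longrightarrow> traj c t > 0"
  by (simp add: admissible_def)

lemma zero_control: "(\<lambda>_. 0) \<in> controls"
  by (simp add: controls_def set_integrable_def)

lemma zero_adm: "(\<lambda>_. 0) \<in> adm" and traj_zero_ge: "t \<ge> 0 \<Longrightarrow> fst \<eta> \<le> traj (\<lambda>_. 0) t"
proof -
  have *: "fst \<eta> \<le> traj (\<lambda>_. 0) t" if "t \<ge> 0" for t
    using that eta0_pos by (intro trajectory_lower_bound zero_control) auto
  then show "t \<ge> 0 \<Longrightarrow> fst \<eta> \<le> traj (\<lambda>_. 0) t" .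
  show "(\<lambda>_. 0) \<in> adm"
    using * eta0_pos by (auto simp: admissible_def zero_control intro: less_le_trans)
qed

text \<open>The mixed trajectory dominates the mixture of two positive trajectories, and at least
  one weight is positive.\<close>

lemma adm_convex:
  assumes b: "b \<in> adm" and c: "c \<in> adm" and u: "u \<ge> 0" "v \<ge> 0" "u + v = 1"
  shows "(\<lambda>t. u * b t + v * c t) \<in> adm"
proof -
  have "0 < traj (\<lambda>t. u * b t + v * c t) t" if t: "t \<ge> 0" for t
  proof -
    have "0 < u * traj b t + v * traj c t"
      using adm_pos[OF b t] adm_pos[OF c t] u
      by (cases "u = 0") (auto intro!: add_pos_nonneg mult_pos_pos)
    also have "\<dots> \<le> traj (\<lambda>t. u * b t + v * c t) t"
      using adm_pos[OF b] adm_pos[OF c]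
      by (intro trajectory_concave adm_controls b c u t) (auto intro: less_imp_le)
    finally show ?thesis .
  qed
  then show ?thesis
    using controls_convex[OF adm_controls[OF b] adm_controls[OF c] u(1,2)] by (simp add: admissible_def)
qed

text \<open>Scaling is mixing with the zero control, whose trajectory never falls below
  \<open>fst \<eta>\<close>.\<close>

lemma scaled_adm:
  assumes c: "c \<in> adm" and l: "0 \<le> l" "l \<le> 1"
  shows "(\<lambda>t. (1 - l) * c t) \<in> adm" "t \<ge> 0 \<Longrightarrow> l * fst \<eta> \<le> traj (\<lambda>t. (1 - l) * c t) t"
proof -
  show "(\<lambda>t. (1 - l) * c t) \<in> adm"
    using adm_convex[OF c zero_adm, of "1 - l" l] l by simp
  assume t: "t \<ge> 0"
  have "l * fst \<eta> \<le> (1 - l) * traj c t + l * traj (\<lambda>_. 0) t"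
    using adm_pos[OF c t] traj_zero_ge[OF t] l by (intro add_increasing mult_left_mono) auto
  also have "\<dots> \<le> traj (\<lambda>t. (1 - l) * c t + l * 0) t"
    using adm_pos[OF c] adm_pos[OF zero_adm] l
    by (intro trajectory_concave adm_controls[OF c] zero_control t) (auto intro: less_imp_le)
  finally show "l * fst \<eta> \<le> traj (\<lambda>t. (1 - l) * c t) t" by simp
qed

lemma objective_eq_J:
  assumes c: "c \<in> controls" and U: "\<And>t. t \<ge> 0 \<Longrightarrow> U (traj c t) = 0"
  shows "objective f0 T D \<rho> U1 U \<eta> c = ereal (J c)"
  unfolding objective_def by (rule ext_integral_discounted[OF c U])

lemma objective_le_J:
  assumes c: "c \<in> adm" and U: "\<And>x. x > 0 \<Longrightarrow> U x \<le> 0"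
  shows "objective f0 T D \<rho> U1 U \<eta> c \<le> ereal (J c)"
proof -
  have "objective f0 T D \<rho> U1 U \<eta> c \<le> ext_integral (\<lambda>t. exp (- \<rho> * t) * (U1 (c t) + 0))"
    unfolding objective_def
    by (intro ext_integral_mono mult_left_mono add_left_mono U adm_pos[OF c]) auto
  then show ?thesis
    using ext_integral_discounted[OF adm_controls[OF c], of "\<lambda>_. 0"] by simp
qed

text \<open>Scaling a control by \<open>1 - l\<close> keeps the capital above \<open>l * fst \<eta>\<close>, where \<open>U\<close> vanishes; so the
  loss does not depend on \<open>U\<close> or on the memory term.\<close>
lemma value_ge_scaled:
  assumes c: "c \<in> adm" and l: "0 \<le> l" "l \<le> 1" and U: "\<And>x. x \<ge> l * fst \<eta> \<Longrightarrow> U x = 0"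
  shows "ereal (J c - l * W) \<le> val U"
proof -
  have "ereal (J c - l * W) \<le> ereal (J (\<lambda>t. (1 - l) * c t))"
    using J_scaled[OF adm_controls[OF c] l] by simp
  also have "\<dots> = objective f0 T D \<rho> U1 U \<eta> (\<lambda>t. (1 - l) * c t)"
    using scaled_adm[OF c l] by (intro objective_eq_J[symmetric] adm_controls U)
  also have "\<dots> \<le> val U"
    unfolding value_fn_def by (intro SUP_upper scaled_adm(1)[OF c l])
  finally show ?thesis .
qed

lemma value_zero_eq_SUP: "val (\<lambda>_. 0) = (SUP c\<in>adm. ereal (J c))"
  unfolding value_fn_def by (intro SUP_cong refl objective_eq_J adm_controls)

lemma J_le_value_zero: "c \<in> adm \<Longrightarrow> ereal (J c) \<le> val (\<lambda>_. 0)"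
  unfolding value_zero_eq_SUP by (rule SUP_upper)

lemma value_zero_finite:
  obtains v where "val (\<lambda>_. 0) = ereal v"
proof -
  have "val (\<lambda>_. 0) \<le> ereal (B / \<rho>)"
    unfolding value_zero_eq_SUP
    using J_abs_le adm_controls by (intro SUP_least) (force simp: abs_le_iff)
  moreover have "ereal (J (\<lambda>_. 0)) \<le> val (\<lambda>_. 0)"
    by (rule J_le_value_zero[OF zero_adm])
  ultimately show ?thesis
    using that by (cases "val (\<lambda>_. 0)") auto
qed

text \<open>Mixing in a little consumption after \<open>M0\<close> pays because \<open>U1'(0+) = \<infinity>\<close>.\<close>
lemma early_stopping_gap:
  assumes M0: "M0 \<ge> 0"
  obtains \<gamma> where "\<gamma> > 0"
    "\<And>c. c \<in> adm \<Longrightarrow> (\<And>t. t > M0 \<Longrightarrow> c t = 0) \<Longrightarrow> ereal (J c + \<gamma>) \<le> val (\<lambda>_. 0)"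
proof -
  define I where "I = {M0<..M0 + 1}"
  define h where "h = fst \<eta> / 2"
  define q where "q = exp (- \<rho> * (M0 + 1))"
  \<comment> \<open>\<open>q\<close> is a lower bound of the discount factor on \<open>I\<close>.
    The slope \<open>K\<close> is calibrated so that consuming \<open>l * h\<close> on
    \<open>I\<close> gains at least \<open>(W + 1) * l\<close>, which exceeds the scaling loss
    \<open>l * W\<close> by \<open>l\<close>.\<close>
  define K where "K = (W + 1) / (h * q)"
  have h: "h > 0" and q: "q > 0"
    using eta0_pos by (simp_all add: h_def q_def)
  have K: "K * h * q = W + 1"
    using h q by (simp add: K_def)
  have K_pos: "K > 0"
    using h q W_pos by (simp add: K_def add_pos_pos)
  \<comment> \<open>The bump control spends half of the initial capital in the unit interval after
    \<open>M0\<close>, so the other half always remains.\<close>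
  define b where "b t = indicator I t * h" for t
  have ind_int: "set_integrable lborel X (\<lambda>t. indicator I t :: real)" if "X \<in> sets borel" for X
  proof -
    have "integrable lborel (\<lambda>t. indicator (X \<inter> I) t :: real)"
      using that by (intro integrable_real_indicator) (auto simp: I_def intro: le_less_trans[OF emeasure_mono])
    then show ?thesis by (simp add: set_integrable_def indicator_inter_arith)
  qed
  have b_ctrl: "b \<in> controls"
    using h ind_int by (auto simp: controls_def b_def[abs_def])
  have b_total: "(LBINT s:{0..t}. b s) \<le> fst \<eta> - h" for t
  proof -
    have "(LBINT s:{0..t}. indicator I s :: real) \<le> (LBINT s:UNIV. indicator I s)"
      unfolding set_lebesgue_integral_def
      by (rule integral_mono) (use ind_int[of "{0..t}"] ind_int[of UNIV] in
          \<open>auto simp: set_integrable_def indicator_def\<close>)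
    also have "\<dots> = 1"
      by (simp add: set_lebesgue_integral_def I_def)
    finally show ?thesis using h by (simp add: b_def[abs_def] h_def)
  qed
  have "h \<le> traj b t" if "t \<ge> 0" for t
    using that h b_total by (intro trajectory_lower_bound b_ctrl) (auto simp: h_def)
  then have b: "b \<in> adm"
    using b_ctrl h by (auto simp: admissible_def intro: less_le_trans)
  obtain z0 where z0: "z0 > 0" "\<And>z. 0 \<le> z \<Longrightarrow> z \<le> z0 \<Longrightarrow> U1 0 + K * z \<le> U1 z"
    using utility_steep_at_0[of K] by blast
  \<comment> \<open>The weight keeps \<open>l * h\<close> in the range where the steep line applies.
    It is fixed before any \<open>c\<close> is given and serves as the gap
    \<open>\<gamma>\<close>.\<close>
  define l where "l = min 1 (z0 / h)"
  have l: "0 < l" "l \<le> 1" "l * h \<le> z0"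
    using z0(1) h by (auto simp: l_def min_def field_simps)
  have "ereal (J c + l) \<le> val (\<lambda>_. 0)" if c: "c \<in> adm" and stop: "\<And>t. t > M0 \<Longrightarrow> c t = 0" for c
  proof -
    define d where "d t = (1 - l) * c t + l * b t" for t
    have d: "d \<in> adm"
      unfolding d_def using l by (intro adm_convex c b) auto
    note ctrl = adm_controls[OF c] adm_controls[OF d]
    note exp_int = set_integrable_exp_tail(1)[OF rho_pos, of 0]
    define g where "g t = (K * h * q * l) * indicator I t" for t
    have g_int: "set_integrable lborel {0..} g"
      unfolding g_def by (intro set_integrable_mult_right ind_int) simp
    have "(LBINT t:{0..}. indicator I t :: real) = (LBINT t. indicator I t)"
      unfolding set_lebesgue_integral_def using M0
      by (intro Bochner_Integration.integral_cong) (auto simp: I_def indicator_def)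
    also have "\<dots> = 1"
      by (simp add: I_def)
    finally have "(LBINT t:{0..}. g t) = (W + 1) * l"
      by (simp add: g_def[abs_def] K)
    then have "J c + l = J c - (LBINT t:{0..}. exp (- \<rho> * t) * (2 * B * l)) + (LBINT t:{0..}. g t)"
      by (simp only: integral_exp_const) (simp add: algebra_simps)
    also have "\<dots> = (LBINT t:{0..}. exp (- \<rho> * t) * U1 (c t) - exp (- \<rho> * t) * (2 * B * l) + g t)"
    proof -
      have 1: "set_integrable lborel {0..} (\<lambda>t. exp (- \<rho> * t) * (2 * B * l))"
        by (intro set_integrable_mult_left exp_int)
      show ?thesis
        unfolding set_integral_add(2)[OF set_integral_diff(1)[OF discounted_integrable[OF ctrl(1)] 1] g_int]
          set_integral_diff(2)[OF discounted_integrable[OF ctrl(1)] 1]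
        by (simp add: discounted_utility_def)
    qed
    also have "\<dots> \<le> J d"
      unfolding discounted_utility_def
    proof (intro set_integral_mono set_integral_add(1) set_integral_diff(1) discounted_integrable ctrl
          set_integrable_mult_left exp_int g_int)
      fix t :: real assume t: "t \<in> {0..}"
      define e where "e = exp (- \<rho> * t)"
      have e: "e > 0" by (simp add: e_def)
      have "e * U1 (c t) - e * (2 * B * l) + g t \<le> e * U1 (d t)"
      proof (cases "t \<in> I")
        case False
        then have "U1 (c t) - 2 * B * l \<le> U1 (d t)"
          using utility_scaled[of "c t" l] controls_nonneg[OF ctrl(1), of t] t l by (simp add: d_def b_def)
        from mult_left_mono[OF this, of e] e False show ?thesis
          by (simp add: g_def right_diff_distrib)
      next
        case True
        \<comment> \<open>On \<open>I\<close> the control \<open>c\<close> has already stopped, so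
          \<open>d\<close> consumes exactly \<open>l * h\<close> and the utility rises from
          \<open>U1 0\<close> along the steep line.\<close>
        have c0: "c t = 0" and d0: "d t = l * h"
          using True stop by (auto simp: I_def d_def b_def)
        have "q \<le> e"
          using True rho_pos by (simp add: q_def e_def I_def)
        then have "q * (K * (l * h)) \<le> e * (K * (l * h))"
          using K_pos l h by (intro mult_right_mono) auto
        moreover have "e * (U1 0 + K * (l * h)) \<le> e * U1 (l * h)"
          using z0(2)[of "l * h"] l h e by (intro mult_left_mono) auto
        moreover have "e * (2 * B * l) \<ge> 0"
          using e B_pos l by simp
        ultimately show ?thesis
          using True by (simp add: g_def c0 d0 algebra_simps)
      qed
      then show "exp (- \<rho> * t) * U1 (c t) - exp (- \<rho> * t) * (2 * B * l) + g t \<le> exp (- \<rho> * t) * U1 (d t)"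
        by (simp add: e_def)
    qed
    finally have "ereal (J c + l) \<le> ereal (J d)" by simp
    also have "\<dots> \<le> val (\<lambda>_. 0)"
      by (rule J_le_value_zero[OF d])
    finally show ?thesis .
  qed
  with l(1) show ?thesis by (rule that)
qed

end

text \<open>A Bochner integral of a nonintegrable function is 0 by convention, which contradicts the
  positivity required for \<open>\<delta> = T\<close>.\<close>

lemma kernel_integrable:
  assumes "kernels T a" "T > 0" "k \<ge> 1"
  shows "set_integrable lborel {-T..0} (a k)"
proof (rule ccontr)
  assume "\<not> set_integrable lborel {-T..0} (a k)"
  then have "(LBINT \<xi>:{-T..0}. a k \<xi>) = 0"
    unfolding set_integrable_def set_lebesgue_integral_def by (rule not_integrable_integral_eq)
  moreover have "\<forall>\<delta>\<in>{0<..T}. (LBINT \<xi>:{-\<delta>..0}. a k \<xi>) > 0"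
    using assms by (simp add: kernels_def)
  then have "(LBINT \<xi>:{-T..0}. a k \<xi>) > 0"
    using assms(2) by simp
  ultimately show False by simp
qed

lemma state_utility_nonpos:
  assumes U2: "state_utilities \<rho> C U2" and n: "n \<ge> 1" and x: "x > 0"
  shows "U2 n x \<le> 0"
proof -
  \<comment> \<open>Shifting by \<open>n \<ge> 1\<close> skips the entry 0 of the sequence; an
    increasing sequence lies below its limit 0.\<close>
  have "incseq (\<lambda>m. U2 (m + n) x)"
    using U2 n x unfolding state_utilities_def by (intro incseq_SucI) simp
  moreover have "(\<lambda>m. U2 (m + n) x) \<longlonglongrightarrow> 0"
    using U2 x unfolding state_utilities_def by (intro LIMSEQ_ignore_initial_segment) blast
  ultimately have "U2 (0 + n) x \<le> 0"
    by (rule incseq_le)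
  then show ?thesis by simp
qed

lemma state_utility_eq_0:
  assumes "state_utilities \<rho> C U2" "n \<ge> 1" "x \<ge> 1 / real n"
  shows "U2 n x = 0"
  using assms by (simp add: state_utilities_def)

section \<open>Choice of the index, near-optimality and convergence of the values\<close>

theorem proposition4p8:
  fixes T \<rho> C :: real
    and f0 :: "real \<Rightarrow> real \<Rightarrow> real"
    and U1 :: "real \<Rightarrow> real"
    and U2 a :: "nat \<Rightarrow> real \<Rightarrow> real"
    and \<eta> :: "real \<times> (real \<Rightarrow> real)"
    and cstar :: "nat \<Rightarrow> nat \<Rightarrow> real \<Rightarrow> real"
    and k :: "real \<Rightarrow> nat \<Rightarrow> nat"
    and M :: "real \<Rightarrow> nat \<Rightarrow> real"
  assumes "T > 0" and "\<rho> > 0"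
    and "production_function f0 C"
    and "consumption_utility U1"
    and "state_utilities \<rho> C U2"
    and "kernels T a"
    and "\<eta> \<in> H_pp T"
    and "\<And>j n. j \<ge> 1 \<Longrightarrow> n \<ge> 1 \<Longrightarrow>
           optimal_feedback_strategy f0 T (distributed_delay T (a j)) \<rho> U1 (U2 n) \<eta> (cstar j n)"
    and "\<And>\<epsilon> n. \<epsilon> > 0 \<Longrightarrow> n \<ge> 1 \<Longrightarrow> k \<epsilon> n \<ge> 1"
    and "\<And>\<epsilon> n. \<epsilon> > 0 \<Longrightarrow> n \<ge> 1 \<Longrightarrow>
           delta_optimal f0 T (pointwise_delay T) \<rho> U1 (U2 n) \<eta> \<epsilon>
             (stop_after (M \<epsilon> n) (cstar (k \<epsilon> n) n))"
  shows "\<exists>N :: real \<Rightarrow> nat.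
           (\<forall>\<epsilon>>0. N \<epsilon> \<ge> 1) \<and>
           ((\<lambda>\<epsilon>. value_fn f0 T (distributed_delay T (a (k \<epsilon> (N \<epsilon>)))) \<rho> U1 (U2 (N \<epsilon>)) \<eta>)
              \<longlongrightarrow> value_fn f0 T (pointwise_delay T) \<rho> U1 (\<lambda>_. 0) \<eta>) (at_right 0) \<and>
           (\<forall>\<epsilon>>0. delta_optimal f0 T (pointwise_delay T) \<rho> U1 (\<lambda>_. 0) \<eta> (3 * \<epsilon>)
                    (stop_after (M \<epsilon> (N \<epsilon>)) (cstar (k \<epsilon> (N \<epsilon>)) (N \<epsilon>))))"
proof -
  note U2 = assms(5) and kernels = assms(6) and cstar_opt = assms(8) and k_ge_1 = assms(9)
    and stopped_opt = assms(10)
  have "bounded (U1 ` {0..})"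
    using assms(4) by (simp add: consumption_utility_def)
  then obtain B where B: "B > 0" "\<And>x. x \<ge> 0 \<Longrightarrow> \<bar>U1 x\<bar> \<le> B"
    by (auto simp: bounded_pos)
  have consumption: "discounted_consumption \<rho> U1 B"
    using assms(2,4) B by unfold_locales auto
  interpret P: delayed_control_problem f0 C T \<eta> "pointwise_delay T" 1 \<rho> U1 B
    by (intro delayed_control_problem.intro delayed_equation_pointwise assms consumption)
  have problem_k: "delayed_control_problem f0 C T \<eta> (distributed_delay T (a j))
      (LBINT \<xi>:{-T..0}. a j \<xi>) \<rho> U1 B" if "j \<ge> 1" for j
    using kernels that unfolding kernels_def
    by (intro delayed_control_problem.intro delayed_equation_distributed assms consumption
        kernel_integrable[OF kernels assms(1) that]) auto
  define Vk where "Vk j n = value_fn f0 T (distributed_delay T (a j)) \<rho> U1 (U2 n) \<eta>" for j n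
  obtain v where v: "P.val (\<lambda>_. 0) = ereal v"
    by (rule P.value_zero_finite)
  \<comment> \<open>A fraction for which the scaling loss \<open>l \<epsilon> * P.W\<close> is at
    most \<open>\<epsilon>\<close>, capped at 1.\<close>
  define l where "l \<epsilon> = min 1 (\<epsilon> / P.W)" for \<epsilon>
  \<comment> \<open>Ensures \<open>1 / real (N \<epsilon>) \<le> l \<epsilon> * fst \<eta>\<close>,
    so the state utility vanishes along every scaled control, whatever the memory term. The choice
    involves neither \<open>k\<close> nor \<open>M\<close>.\<close>
  define N where "N \<epsilon> = Suc (nat \<lceil>1 / (l \<epsilon> * fst \<eta>)\<rceil>)" for \<epsilon>
  define s where "s \<epsilon> = stop_after (M \<epsilon> (N \<epsilon>)) (cstar (k \<epsilon> (N \<epsilon>)) (N \<epsilon>))" for \<epsilon>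
  have N1: "N \<epsilon> \<ge> 1" for \<epsilon>
    by (simp add: N_def)
  have l: "0 < l \<epsilon>" "l \<epsilon> \<le> 1" "l \<epsilon> * P.W \<le> \<epsilon>" if "\<epsilon> > 0" for \<epsilon>
  proof -
    show "0 < l \<epsilon>" "l \<epsilon> \<le> 1"
      using that P.W_pos by (simp_all only: l_def min_less_iff_conj divide_pos_pos) auto
    have "l \<epsilon> \<le> \<epsilon> / P.W"
      by (simp add: l_def)
    then show "l \<epsilon> * P.W \<le> \<epsilon>"
      using P.W_pos by (simp only: pos_le_divide_eq)
  qed
  have U2_zero: "U2 (N \<epsilon>) x = 0" if \<epsilon>: "\<epsilon> > 0" and x: "x \<ge> l \<epsilon> * fst \<eta>" for \<epsilon> x
  proof (rule state_utility_eq_0[OF U2 N1])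
    have "1 / (l \<epsilon> * fst \<eta>) \<le> real (N \<epsilon>)"
      unfolding N_def by linarith
    then have "1 / real (N \<epsilon>) \<le> l \<epsilon> * fst \<eta>"
      using l(1)[OF \<epsilon>] P.eta0_pos N1[of \<epsilon>] by (simp add: field_simps)
    with x show "1 / real (N \<epsilon>) \<le> x" by simp
  qed
  have s_adm: "s \<epsilon> \<in> P.adm" and s_near: "v - 2 * \<epsilon> < P.J (s \<epsilon>)" if \<epsilon>: "\<epsilon> > 0" for \<epsilon>
  proof -
    have opt: "delta_optimal f0 T (pointwise_delay T) \<rho> U1 (U2 (N \<epsilon>)) \<eta> \<epsilon> (s \<epsilon>)"
      unfolding s_def by (rule stopped_opt[OF \<epsilon> N1])
    then show adm: "s \<epsilon> \<in> P.adm"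
      by (simp add: delta_optimal_def)
    \<comment> \<open>The first \<open>\<epsilon>\<close> pays for scaling each competitor; the
      second comes from the \<open>\<epsilon>\<close>-optimality of the stopped strategy.\<close>
    have "P.val (\<lambda>_. 0) \<le> P.val (U2 (N \<epsilon>)) + ereal \<epsilon>"
      unfolding P.value_zero_eq_SUP
    proof (rule SUP_least)
      fix c assume c: "c \<in> P.adm"
      have "ereal (P.J c - l \<epsilon> * P.W) \<le> P.val (U2 (N \<epsilon>))"
        using l[OF \<epsilon>] by (intro P.value_ge_scaled c U2_zero \<epsilon>) auto
      then have "ereal (P.J c - l \<epsilon> * P.W) + ereal \<epsilon> \<le> P.val (U2 (N \<epsilon>)) + ereal \<epsilon>"
        by (rule add_right_mono)
      moreover have "ereal (P.J c) \<le> ereal (P.J c - l \<epsilon> * P.W) + ereal \<epsilon>"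
        using l(3)[OF \<epsilon>] by simp
      ultimately show "ereal (P.J c) \<le> P.val (U2 (N \<epsilon>)) + ereal \<epsilon>"
        by (rule order_trans[rotated])
    qed
    moreover have "P.val (U2 (N \<epsilon>)) - ereal \<epsilon> < ereal (P.J (s \<epsilon>))"
    proof (rule less_le_trans)
      show "P.val (U2 (N \<epsilon>)) - ereal \<epsilon> < objective f0 T (pointwise_delay T) \<rho> U1 (U2 (N \<epsilon>)) \<eta> (s \<epsilon>)"
        using opt unfolding delta_optimal_def by (rule conjunct2)
      show "objective f0 T (pointwise_delay T) \<rho> U1 (U2 (N \<epsilon>)) \<eta> (s \<epsilon>) \<le> ereal (P.J (s \<epsilon>))"
        by (intro P.objective_le_J adm state_utility_nonpos[OF U2 N1])
    qed
    \<comment> \<open>The value with state utility is finite: the first bound excludes -\<infinity>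
      because \<open>v\<close> is real, the second excludes \<infinity>.\<close>
    ultimately show "v - 2 * \<epsilon> < P.J (s \<epsilon>)"
      unfolding v by (cases "P.val (U2 (N \<epsilon>))") auto
  qed
  have near_optimal: "delta_optimal f0 T (pointwise_delay T) \<rho> U1 (\<lambda>_. 0) \<eta> (3 * \<epsilon>) (s \<epsilon>)"
    if \<epsilon>: "\<epsilon> > 0" for \<epsilon>
    using s_adm[OF \<epsilon>] s_near[OF \<epsilon>] \<epsilon>
    by (simp add: delta_optimal_def v P.objective_eq_J[OF P.adm_controls])
  have bounds: "ereal (v - 3 * \<epsilon>) \<le> Vk (k \<epsilon> (N \<epsilon>)) (N \<epsilon>)"
    "Vk (k \<epsilon> (N \<epsilon>)) (N \<epsilon>) \<le> ereal (v + P.W * exp (- \<rho> * M \<epsilon> (N \<epsilon>)))" if \<epsilon>: "\<epsilon> > 0" for \<epsilon>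
  proof -
    define j where "j = k \<epsilon> (N \<epsilon>)"
    define c where "c = cstar j (N \<epsilon>)"
    have j: "j \<ge> 1"
      unfolding j_def by (rule k_ge_1[OF \<epsilon> N1])
    interpret K: delayed_control_problem f0 C T \<eta> "distributed_delay T (a j)"
      "LBINT \<xi>:{-T..0}. a j \<xi>" \<rho> U1 B
      by (rule problem_k[OF j])
    have c: "c \<in> K.adm" and val: "Vk j (N \<epsilon>) = objective f0 T (distributed_delay T (a j)) \<rho> U1 (U2 (N \<epsilon>)) \<eta> c"
      using cstar_opt[OF j N1, of \<epsilon>] by (auto simp: optimal_feedback_strategy_def c_def Vk_def)
    have s: "s \<epsilon> = stop_after (M \<epsilon> (N \<epsilon>)) c"
      by (simp add: s_def c_def j_def)
    \<comment> \<open>The full strategy is admissible for the kernel problem and its stopped version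
      for the pointwise one; \<open>J\<close> sees only the control and links the two.\<close>
    note J = P.J_stop_after[OF K.adm_controls[OF c] P.adm_controls[OF s_adm[OF \<epsilon>, unfolded s]], folded s]
    \<comment> \<open>Removing the stopping does not lower the utility, so \<open>c\<close> is
      within \<open>2 * \<epsilon>\<close> of \<open>v\<close>; scaling it inside the kernel problem
      costs one more \<open>\<epsilon>\<close>.\<close>
    have "ereal (v - 3 * \<epsilon>) \<le> ereal (P.J c - l \<epsilon> * P.W)"
      using J(1) s_near[OF \<epsilon>] l(3)[OF \<epsilon>] by simp
    also have "\<dots> \<le> Vk j (N \<epsilon>)"
      unfolding Vk_def using l[OF \<epsilon>] by (intro K.value_ge_scaled c U2_zero \<epsilon>) auto
    finally show "ereal (v - 3 * \<epsilon>) \<le> Vk (k \<epsilon> (N \<epsilon>)) (N \<epsilon>)"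
      by (simp add: j_def)
    \<comment> \<open>The state utility is nonpositive, so the optimal value is at most the
      consumption utility of \<open>c\<close>; stopping changes that only by the tail.\<close>
    have "Vk j (N \<epsilon>) \<le> ereal (P.J c)"
      unfolding val by (intro K.objective_le_J c state_utility_nonpos[OF U2 N1])
    also have "\<dots> \<le> ereal (P.J (s \<epsilon>) + P.W * exp (- \<rho> * M \<epsilon> (N \<epsilon>)))"
      using J(2) by simp
    also have "\<dots> \<le> ereal (v + P.W * exp (- \<rho> * M \<epsilon> (N \<epsilon>)))"
      using P.J_le_value_zero[OF s_adm[OF \<epsilon>]] by (simp add: v)
    finally show "Vk (k \<epsilon> (N \<epsilon>)) (N \<epsilon>) \<le> ereal (v + P.W * exp (- \<rho> * M \<epsilon> (N \<epsilon>)))"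
      by (simp add: j_def)
  qed
  have M_lim: "filterlim (\<lambda>\<epsilon>. M \<epsilon> (N \<epsilon>)) at_top (at_right 0)"
    \<comment> \<open>Positive thresholds suffice for divergence, and they fall under the early
      stopping gap.\<close>
    unfolding filterlim_at_top_gt[where c = 0]
  proof (intro allI impI)
    fix M0 :: real assume M0: "M0 > 0"
    obtain \<gamma> where \<gamma>: "\<gamma> > 0"
      "\<And>c. c \<in> P.adm \<Longrightarrow> (\<And>t. t > M0 \<Longrightarrow> c t = 0) \<Longrightarrow> ereal (P.J c + \<gamma>) \<le> P.val (\<lambda>_. 0)"
      using P.early_stopping_gap[of M0] M0 by (auto intro: less_imp_le)
    have "\<forall>\<^sub>F \<epsilon> in at_right 0. \<epsilon> < \<gamma> / 2"
      using \<gamma>(1) by (intro eventually_at_right_real[THEN eventually_mono, of 0 "\<gamma> / 2"]) auto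
    then show "\<forall>\<^sub>F \<epsilon> in at_right 0. M0 \<le> M \<epsilon> (N \<epsilon>)"
      using eventually_at_right_less[of "0::real"]
    proof eventually_elim
      case (elim \<epsilon>)
      show ?case
      proof (rule ccontr)
        \<comment> \<open>The strategy would then consume nothing after \<open>M0\<close> and miss
          \<open>v\<close> by at least \<open>\<gamma>\<close>, although it is within
          \<open>2 * \<epsilon> < \<gamma>\<close> of it.\<close>
        assume "\<not> M0 \<le> M \<epsilon> (N \<epsilon>)"
        then have "P.J (s \<epsilon>) + \<gamma> \<le> v"
          using \<gamma>(2)[OF s_adm[OF elim(2)]] by (simp add: v s_def stop_after_def)
        then show False
          using s_near[OF elim(2)] elim(1) by simp
      qed
    qed
  qed
  have lim: "((\<lambda>\<epsilon>. Vk (k \<epsilon> (N \<epsilon>)) (N \<epsilon>)) \<longlongrightarrow> ereal v) (at_right 0)"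
  proof (rule tendsto_sandwich)
    show "\<forall>\<^sub>F \<epsilon> in at_right 0. ereal (v - 3 * \<epsilon>) \<le> Vk (k \<epsilon> (N \<epsilon>)) (N \<epsilon>)"
      using eventually_at_right_less by eventually_elim (rule bounds)
    show "\<forall>\<^sub>F \<epsilon> in at_right 0. Vk (k \<epsilon> (N \<epsilon>)) (N \<epsilon>) \<le> ereal (v + P.W * exp (- \<rho> * M \<epsilon> (N \<epsilon>)))"
      using eventually_at_right_less by eventually_elim (rule bounds)
    have "((\<lambda>\<epsilon>. v - 3 * \<epsilon>) \<longlongrightarrow> v - 3 * 0) (at_right 0)"
      by (intro tendsto_intros)
    then show "((\<lambda>\<epsilon>. ereal (v - 3 * \<epsilon>)) \<longlongrightarrow> ereal v) (at_right 0)"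
      by simp
    have "((\<lambda>\<epsilon>. exp (- \<rho> * M \<epsilon> (N \<epsilon>))) \<longlongrightarrow> 0) (at_right 0)"
      using assms(2) M_lim
      by (intro filterlim_compose[OF exp_at_bot] filterlim_tendsto_neg_mult_at_bot[OF tendsto_const]) auto
    then have "((\<lambda>\<epsilon>. v + P.W * exp (- \<rho> * M \<epsilon> (N \<epsilon>))) \<longlongrightarrow> v + P.W * 0) (at_right 0)"
      by (intro tendsto_intros)
    then show "((\<lambda>\<epsilon>. ereal (v + P.W * exp (- \<rho> * M \<epsilon> (N \<epsilon>)))) \<longlongrightarrow> ereal v) (at_right 0)"
      by simp
  qed
  show ?thesis
    using N1 lim near_optimal unfolding Vk_def s_def v by (intro exI[of _ N]) simp
qed

end
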